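(* Let $\beta>0$, $0<\gamma\le 1$, and suppose that $p_{X,Z}\in\mathcal{P}_{\beta,\gamma}$. Let $\hat p_{X|Z}$ be the estimator $$\hat p_{X|Z}(x|z)=\sum_{\bar j\in[m]^{d_Z}}\mathbf{1}(z\in A_{\bar j})\,\frac{\sum_{i=1}^n\mathbf{1}(Z_i\in A_{\bar j})\,K\!\left(\frac{X_i-x}{h}\right)}{h^{d_X}\sum_{i=1}^n\mathbf{1}(Z_i\in A_{\bar j})}$$ with an appropriate kernel $K$. Selecting the parameters $h\asymp n^{\frac{-1}{d_X+d_Z\beta\gamma^{-1}+2\beta}}$ and $m\asymp n^{\frac{\beta}{d_X+d_Z\beta\gamma^{-1}+2\beta}}$ (for some appropriately selected constants, $m$ a positive integer), we have $$\mathbb{E}\int\int|\hat p_{X|Z}(x|z)-p_{X|Z}(x|z)|\,p_Z(z)\,dx\,dz\ \lesssim\ n^{\frac{-1}{\beta^{-1}d_X+\gamma^{-1}d_Z+2}}.$$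
   Context: Setting: $X\in[0,1]^{d_X}$, $Z\in[0,1]^{d_Z}$ have a joint density $p_{X,Z}=p_{X|Z}\,p_Z$ with respect to Lebesgue measure on $[0,1]^{d_X+d_Z}$; no assumption is made on $p_Z$. $(X_1,Z_1),\dots,(X_n,Z_n)$ are i.i.d. from $p_{X,Z}$ and $\mathbb{E}$ is the expectation over these samples. Integrals in $x$ and $z$ are over $[0,1]^{d_X}$ and $[0,1]^{d_Z}$. The symbols $\lesssim,\gtrsim,\asymp$ denote (in)equalities up to positive multiplicative constants not depending on $n$ or on the particular distribution in $\mathcal{P}_{\beta,\gamma}$ (they may depend on the fixed quantities $\beta,\gamma,d_X,d_Z,W_1,W_2,K$). The class $\mathcal{P}_{\beta,\gamma}$. $\lfloor\beta\rfloor$ is the greatest integer strictly less than $\beta$, and $\ell=\lfloor\beta\rfloor$. With fixed positive constants $W_1$ and (sufficiently large) $W_2$, $\mathcal{P}_{\beta,\gamma}$ is the class of such distributions for which: (Hölder smoothness in $x$) $p_{X|Z}(x|z)$ is $\ell$ times differentiable in $x$ and for all $x,x'\in[0,1]^{d_X}$, $z\in[0,1]^{d_Z}$ and multi-indices $\alpha\in\mathbb{N}_0^{d_X}$ with $\|\alpha\|_1=\ell$: $|D^\alpha p_{X|Z}(x|z)-D^\alpha p_{X|Z}(x'|z)|\le W_1\|x-x'\|_1^{\beta-\ell}$; ($\gamma$-TV smoothness in $z$) for all $z,z'\in[0,1]^{d_Z}$: $\|p_{X|Z=z}-p_{X|Z=z'}\|_1=\int|p_{X|Z}(x|z)-p_{X|Z}(x|z')|dx\le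 W_2\|z-z'\|_1^\gamma$. Appropriate kernel: $K:\mathbb{R}^{d_X}\to\mathbb{R}$ with $\int K(u)du=1$; $\int u^\alpha K(u)du=0$ for all $\alpha\in\mathbb{N}_0^{d_X}$ with $1\le\|\alpha\|_1\le\ell$; $\int K^2(u)du<\infty$; and $\int|K(u)||u^\alpha|du<\infty$ for all $\alpha\in\mathbb{R}_+^{d_X}$ with $\|\alpha\|_1\le\beta$, where $\mathbb{R}_+=[0,\infty)$ and $u^\alpha=\prod_i u_i^{\alpha_i}$. Bins: $[0,1]$ is partitioned into intervals $A_1,\dots,A_m$ of equal length $1/m$; for $\bar j=(j_1,\dots,j_{d_Z})\in[m]^{d_Z}$, $[m]=\{1,\dots,m\}$, $A_{\bar j}=\prod_{k=1}^{d_Z}A_{j_k}$ (Cartesian product). The ratio $\frac00$ is understood as $0$.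
   Formalization: The exponent of m is (β/γ)/(d_X+d_Zβ/γ+2β) instead of β/(...), as the printed one fails for γ<1; "ℓ times differentiable in x" is on all of R^{d_X} with the density zero off the cube, since otherwise the uniform density has boundary bias of order h and the rate fails for β>1. *)

theory Defs
  imports "HOL-Analysis.Analysis" "HOL-Library.Landau_Symbols"
begin

abbreviation unit_cube :: "(real ^ 'd) set" where
  "unit_cube \<equiv> cbox 0 1"

definition l1_norm :: "real ^ 'd \<Rightarrow> real" where
  "l1_norm x = (\<Sum>i\<in>UNIV. \<bar>x $ i\<bar>)"

(* The greatest integer strictly less than b; used for b > 0 only, where it is a natural number. *)
definition strict_floor :: "real \<Rightarrow> nat" where
  "strict_floor b = (GREATEST k. real k < b)"

definition partial_deriv :: "'d \<Rightarrow> (real ^ 'd \<Rightarrow> real) \<Rightarrow> real ^ 'd \<Rightarrow> real" where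
  "partial_deriv i f x = deriv (\<lambda>t. f (x + t *\<^sub>R axis i 1)) 0"

primrec times_differentiable :: "nat \<Rightarrow> (real ^ 'd \<Rightarrow> real) \<Rightarrow> bool" where
  "times_differentiable 0 f \<longleftrightarrow> True"
| "times_differentiable (Suc k) f \<longleftrightarrow>
     (\<forall>x. f differentiable (at x)) \<and> (\<forall>i. times_differentiable k (partial_deriv i f))"

(* A list of coordinates in which i occurs alpha i times gives the derivative D^alpha;
   for a function that is length-many times differentiable the order is immaterial. *)
definition iterated_partial :: "'d list \<Rightarrow> (real ^ 'd \<Rightarrow> real) \<Rightarrow> real ^ 'd \<Rightarrow> real" where
  "iterated_partial is f = foldr partial_deriv is f"

definition holder_in_x :: "real \<Rightarrow> real \<Rightarrow> (real ^ 'dx \<Rightarrow> real ^ 'dz \<Rightarrow> real) \<Rightarrow> bool" where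
  "holder_in_x \<beta> W p \<longleftrightarrow>
     (\<forall>z\<in>unit_cube. times_differentiable (strict_floor \<beta>) (\<lambda>x. p x z)) \<and>
     (\<forall>x\<in>unit_cube. \<forall>x'\<in>unit_cube. \<forall>z\<in>unit_cube. \<forall>\<alpha> :: 'dx \<Rightarrow> nat.
        (\<Sum>i\<in>UNIV. \<alpha> i) = strict_floor \<beta> \<longrightarrow>
        (\<forall>is. (\<forall>i. count_list is i = \<alpha> i) \<longrightarrow>
           \<bar>iterated_partial is (\<lambda>x. p x z) x - iterated_partial is (\<lambda>x. p x z) x'\<bar>
             \<le> W * l1_norm (x - x') powr (\<beta> - real (strict_floor \<beta>))))"

definition tv_smooth_in_z :: "real \<Rightarrow> real \<Rightarrow> (real ^ 'dx \<Rightarrow> real ^ 'dz \<Rightarrow> real) \<Rightarrow> bool" where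
  "tv_smooth_in_z \<gamma> W p \<longleftrightarrow>
     (\<forall>z\<in>unit_cube. \<forall>z'\<in>unit_cube.
        (\<integral>\<^sup>+x\<in>unit_cube. ennreal \<bar>p x z - p x z'\<bar> \<partial>lborel)
          \<le> ennreal (W * l1_norm (z - z') powr \<gamma>))"

(* p x z is the conditional density p(x|z) and q the marginal density of Z.  Densities are
   functions on the whole space that vanish off the cube, and times_differentiable refers to
   this extension: when the order is positive, p(.|z) vanishes smoothly at the boundary.
   Without this, the uniform density would contribute a boundary bias of order h, which
   exceeds h^beta for beta > 1. *)
definition density_class ::
  "real \<Rightarrow> real \<Rightarrow> real \<Rightarrow> real \<Rightarrow> ((real ^ 'dx \<Rightarrow> real ^ 'dz \<Rightarrow> real) \<times> (real ^ 'dz \<Rightarrow> real)) set" where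
  "density_class \<beta> \<gamma> W1 W2 = {(p, q).
     case_prod p \<in> borel_measurable borel \<and> q \<in> borel_measurable borel \<and>
     (\<forall>x z. 0 \<le> p x z) \<and> (\<forall>z. 0 \<le> q z) \<and>
     (\<forall>x z. x \<notin> unit_cube \<longrightarrow> p x z = 0) \<and> (\<forall>z. z \<notin> unit_cube \<longrightarrow> q z = 0) \<and>
     (\<forall>z\<in>unit_cube. (\<integral>\<^sup>+x. ennreal (p x z) \<partial>lborel) = 1) \<and>
     (\<integral>\<^sup>+z. ennreal (q z) \<partial>lborel) = 1 \<and>
     holder_in_x \<beta> W1 p \<and> tv_smooth_in_z \<gamma> W2 p}"

(* For real exponents u^alpha only enters through its absolute value.  The convention
   0 powr 0 = 0 affects a null set only.  The integrability of u^alpha K(u) in the third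
   condition follows from the last one. *)
definition appropriate_kernel :: "real \<Rightarrow> (real ^ 'dx \<Rightarrow> real) \<Rightarrow> bool" where
  "appropriate_kernel \<beta> K \<longleftrightarrow>
     integrable lborel K \<and> (\<integral>u. K u \<partial>lborel) = 1 \<and>
     (\<forall>\<alpha> :: 'dx \<Rightarrow> nat. 1 \<le> (\<Sum>i\<in>UNIV. \<alpha> i) \<and> (\<Sum>i\<in>UNIV. \<alpha> i) \<le> strict_floor \<beta> \<longrightarrow>
        (\<integral>u. (\<Prod>i\<in>UNIV. u $ i ^ \<alpha> i) * K u \<partial>lborel) = 0) \<and>
     integrable lborel (\<lambda>u. (K u)\<^sup>2) \<and>
     (\<forall>\<alpha> :: 'dx \<Rightarrow> real. (\<forall>i. 0 \<le> \<alpha> i) \<and> (\<Sum>i\<in>UNIV. \<alpha> i) \<le> \<beta> \<longrightarrow>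
        integrable lborel (\<lambda>u. \<bar>K u\<bar> * (\<Prod>i\<in>UNIV. \<bar>u $ i\<bar> powr \<alpha> i)))"

(* A_1, ..., A_m, half-open except that the last one contains 1. *)
definition bin_interval :: "nat \<Rightarrow> nat \<Rightarrow> real set" where
  "bin_interval m j =
     (if j = m then {(real m - 1) / real m..1} else {(real j - 1) / real m..<real j / real m})"

definition bin :: "nat \<Rightarrow> ('dz \<Rightarrow> nat) \<Rightarrow> (real ^ 'dz) set" where
  "bin m j = {z. \<forall>k. z $ k \<in> bin_interval m (j k)}"

(* s i = (X_i, Z_i) for i = 1, ..., n; an empty bin gives 0 / 0 = 0. *)
definition cond_density_estimator ::
  "(real ^ 'dx \<Rightarrow> real) \<Rightarrow> real \<Rightarrow> nat \<Rightarrow> nat \<Rightarrow> (nat \<Rightarrow> (real ^ 'dx) \<times> (real ^ 'dz)) \<Rightarrow>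
     real ^ 'dx \<Rightarrow> real ^ 'dz \<Rightarrow> real" where
  "cond_density_estimator K h m n s x z =
     (\<Sum>j | \<forall>k. j k \<in> {1..m}. indicator (bin m j) z *
        ((\<Sum>i = 1..n. indicator (bin m j) (snd (s i)) * K ((fst (s i) - x) /\<^sub>R h)) /
         (h ^ CARD('dx) * (\<Sum>i = 1..n. indicator (bin m j) (snd (s i))))))"

definition joint_law ::
  "(real ^ 'dx \<Rightarrow> real ^ 'dz \<Rightarrow> real) \<Rightarrow> (real ^ 'dz \<Rightarrow> real) \<Rightarrow> ((real ^ 'dx) \<times> (real ^ 'dz)) measure" where
  "joint_law p q = density lborel (\<lambda>(x, z). ennreal (p x z * q z))"

(* Valued in ennreal, so that a non-integrable loss cannot be read as 0. *)
definition estimator_risk ::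
  "(real ^ 'dx \<Rightarrow> real) \<Rightarrow> real \<Rightarrow> nat \<Rightarrow> nat \<Rightarrow>
     (real ^ 'dx \<Rightarrow> real ^ 'dz \<Rightarrow> real) \<Rightarrow> (real ^ 'dz \<Rightarrow> real) \<Rightarrow> ennreal" where
  "estimator_risk K h m n p q =
     (\<integral>\<^sup>+s. (\<integral>\<^sup>+z\<in>unit_cube. (\<integral>\<^sup>+x\<in>unit_cube.
         ennreal (\<bar>cond_density_estimator K h m n s x z - p x z\<bar> * q z) \<partial>lborel) \<partial>lborel)
       \<partial>(\<Pi>\<^sub>M i\<in>{1..n}. joint_law p q))"

end

theory Submission
  imports Defs "HOL-Probability.Infinite_Product_Measure"
begin

text \<open>
  Write \<open>K\<^sub>h(u) = K (u / h) / h ^ d\<^sub>X\<close>. Fix a bin \<open>A\<close> of mass \<open>\<mu>\<close> under the law of \<open>Z\<close>, let \<open>N\<close> be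
  the number of sample points with \<open>Z\<^sub>i \<in> A\<close>, and let \<open>c\<close> be the mean of \<open>K\<^sub>h(X - x)\<close> given
  \<open>Z \<in> A\<close>. For \<open>z \<in> A\<close> the estimator at \<open>(x, z)\<close> averages \<open>K\<^sub>h(X\<^sub>i - x)\<close> over these \<open>N\<close> points, so
  its error consists of the fluctuation of this average about \<open>c\<close>, of the bias \<open>c - p x z\<close> and, when
  \<open>N = 0\<close>, of \<open>p x z\<close> itself.

  Fluctuation. The centred summands \<open>\<phi>\<^sub>i = 1(Z\<^sub>i \<in> A) (K\<^sub>h(X\<^sub>i - x) - c)\<close> are independent with mean
  zero. Wherever \<open>\<phi>\<^sub>i \<noteq> 0\<close> one has \<open>N = 1 + N\<^sub>i\<close> with \<open>N\<^sub>i\<close>, the number of other hits, independent of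
  the \<open>i\<close>-th point. Hence the mixed terms in the expectation of \<open>(\<Sum> \<phi>\<^sub>i)\<^sup>2 / N\<close> vanish, and the
  diagonal is controlled by \<open>\<Sum> E (1 / (1 + N\<^sub>i)) \<le> 1 / \<mu>\<close> (\<open>sum_expectation_inv_others\<close>). This holds
  because \<open>\<mu> E (1 / (1 + N\<^sub>i))\<close> is the expectation of \<open>1(Z\<^sub>i \<in> A) / N\<close>, and these ratios add up to at
  most 1; the same sum bounds the probability of an empty bin. The arithmetic-geometric mean inequality
  \<open>\<bar>\<Sum> \<phi>\<^sub>i / N\<bar> \<le> (\<tau> / 2) (\<Sum> \<phi>\<^sub>i)\<^sup>2 / N + 1 / (2 \<tau> N)\<close> is used with one weight \<open>\<tau>\<close> for all bins. As a
  result \<open>\<mu>\<close> cancels when the error in the bin is multiplied by \<open>\<mu>\<close>, and summing over the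
  \<open>m ^ d\<^sub>Z\<close> bins gives \<open>\<tau> \<integral>K\<^sup>2 / (2 h ^ d\<^sub>X) + (1 / \<tau> + 1) m ^ d\<^sub>Z / n\<close>, whatever the law of \<open>Z\<close>
  (\<open>expected_local_average_error\<close>, \<open>estimator_risk_le\<close>).

  Bias. The constant \<open>c\<close> is an average over \<open>z' \<in> A\<close> of the smoothed densities
  \<open>\<integral>K u p (x + h u) z' du\<close>. Replacing such a density by \<open>p x z'\<close> costs a multiple of \<open>h powr \<beta>\<close> in
  \<open>L\<^sup>1\<close> (\<open>kernel_bias\<close>); for \<open>\<beta> > 1\<close> this is Taylor expansion with the vanishing moments of \<open>K\<close>. Replacing \<open>p x z'\<close> by
  \<open>p x z\<close> costs \<open>W2 (d\<^sub>Z / m) powr \<gamma>\<close>, because \<open>d\<^sub>Z / m\<close> is the diameter of the bin. The Hoelder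
  condition compares only points of the cube. For \<open>\<beta> > 1\<close> it extends to all points \<open>x + h u\<close>, because the
  derivatives of a density that is differentiable everywhere and vanishes off the cube vanish on the
  boundary too. For \<open>\<beta> \<le> 1\<close> the density may jump at the boundary, but only a set of \<open>x\<close> of small
  volume is carried across it by the shift \<open>h u\<close>.

  With \<open>D = d\<^sub>X + d\<^sub>Z \<beta> / \<gamma> + 2 \<beta>\<close> and \<open>\<tau> = n powr (- \<beta> / D) h ^ d\<^sub>X\<close>, the prescribed \<open>h\<close> and \<open>m\<close> make
  every term at most of the order \<open>n powr (- \<beta> / D)\<close>, which is the asserted rate
  (\<open>balanced_risk_bound\<close>).
\<close>

section \<open>Averages over the sample points in a cell\<close>

text \<open>Independent samples \<open>s i \<sim> P\<close> for \<open>i \<in> I\<close>, of which only those in the cell \<open>S\<close> are used. The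
  cell will be the set of all \<open>(x, z)\<close> with \<open>z\<close> in a given bin.\<close>

locale hit_count = prob_space P for P :: "'a measure" +
  fixes I :: "'i set" and S :: "'a set"
  assumes finite_I: "finite I" and I_nonempty: "I \<noteq> {}"
    and S_sets [measurable]: "S \<in> sets P" and S_pos: "0 < prob S"
begin

abbreviation Q :: "('i \<Rightarrow> 'a) measure" where "Q \<equiv> PiM I (\<lambda>_. P)"

definition hits :: "('i \<Rightarrow> 'a) \<Rightarrow> real" where
  "hits s = (\<Sum>i\<in>I. indicat_real S (s i))"

text \<open>On the event that the \<open>i\<close>-th sample hits \<open>S\<close> this equals \<open>1 / hits s\<close>, but it does not depend on
  \<open>s i\<close>. Replacing one by the other is what makes the random denominator harmless.\<close>

definition inv_others :: "'i \<Rightarrow> ('i \<Rightarrow> 'a) \<Rightarrow> real" where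
  "inv_others i s = 1 / (1 + (\<Sum>k\<in>I - {i}. indicat_real S (s k)))"

lemma hits_measurable [measurable]: "hits \<in> borel_measurable Q"
  unfolding hits_def by measurable

lemma inv_others_measurable [measurable]: "inv_others i \<in> borel_measurable Q"
  unfolding inv_others_def by measurable

sublocale sample: prob_space Q
  by (rule prob_space_PiM) (rule prob_space_axioms)

lemma inv_others_bounds: "0 \<le> inv_others i s" "inv_others i s \<le> 1"
proof -
  have "0 \<le> (\<Sum>k\<in>I - {i}. indicat_real S (s k))" by (intro sum_nonneg) simp
  then show "0 \<le> inv_others i s" "inv_others i s \<le> 1"
    by (auto simp: inv_others_def divide_simps)
qed

lemma hits_split: "i \<in> I \<Longrightarrow> hits s = indicat_real S (s i) + (\<Sum>k\<in>I - {i}. indicat_real S (s k))"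
  unfolding hits_def using finite_I by (simp add: sum.remove)

lemma hits_nonneg: "0 \<le> hits s"
  unfolding hits_def by (intro sum_nonneg) simp

lemma hits_zero_or_ge_1: "hits s = 0 \<or> 1 \<le> hits s"
proof (cases "\<exists>i\<in>I. s i \<in> S")
  case True
  then obtain i where i: "i \<in> I" "s i \<in> S" by auto
  have "0 \<le> (\<Sum>k\<in>I - {i}. indicat_real S (s k))" by (intro sum_nonneg) simp
  with i show ?thesis by (simp add: hits_split)
next
  case False then show ?thesis by (simp add: hits_def)
qed

lemma inv_hits_eq:
  assumes "i \<in> I" "\<phi> \<noteq> 0 \<Longrightarrow> s i \<in> S"
  shows "\<phi> / hits s = \<phi> * inv_others i s"
  using assms by (cases "\<phi> = 0") (auto simp: hits_split inv_others_def)

lemma integrable_inv_others [simp]: "integrable Q (inv_others i)"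
  by (rule sample.integrable_const_bound[where B=1])
     (use inv_others_bounds in auto)

lemma integrable_coordinate:
  fixes \<psi> :: "'a \<Rightarrow> real"
  assumes "i \<in> I" "integrable P \<psi>"
  shows "integrable Q (\<lambda>s. \<psi> (s i))"
proof -
  have "distr Q P (\<lambda>s. s i) = P"
    by (rule distr_PiM_component) (auto simp: assms prob_space_axioms)
  then have "integrable (distr Q P (\<lambda>s. s i)) \<psi>" using assms by simp
  then show ?thesis 
    by (subst (asm) integrable_distr_eq) (use assms in auto)
qed

text \<open>Independence of one sample from the others, as Fubini's theorem for the product over
  \<open>insert i (I - {i})\<close>.\<close>

lemma integral_coordinate_times:
  fixes \<psi> :: "'a \<Rightarrow> real" and F :: "('i \<Rightarrow> 'a) \<Rightarrow> real"
  assumes i: "i \<in> I"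
    and indep: "\<And>s a. F (s(i := a)) = F s"
    and F: "integrable Q F" and \<psi>F: "integrable Q (\<lambda>s. \<psi> (s i) * F s)"
  shows "(\<integral>s. \<psi> (s i) * F s \<partial>Q) = (\<integral>a. \<psi> a \<partial>P) * (\<integral>s. F s \<partial>Q)"
proof -
  interpret product_sigma_finite "\<lambda>_. P"
    by (simp add: product_sigma_finite_def sigma_finite_measure_axioms)
  let ?J = "I - {i}"
  have I: "I = insert i ?J" using i by auto
  have fin: "finite ?J" and notin: "i \<notin> ?J" using finite_I by auto
  note ins = product_integral_insert[OF fin notin, folded I]
  have "(\<integral>s. \<psi> (s i) * F s \<partial>Q) = (\<integral>s. (\<integral>a. \<psi> a * F s \<partial>P) \<partial>PiM ?J (\<lambda>_. P))"
    by (subst ins[OF \<psi>F]) (simp add: indep)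
  also have "\<dots> = (\<integral>a. \<psi> a \<partial>P) * (\<integral>s. F s \<partial>PiM ?J (\<lambda>_. P))"
    by simp
  also have "(\<integral>s. F s \<partial>PiM ?J (\<lambda>_. P)) = (\<integral>s. F s \<partial>Q)"
    by (subst ins[OF F]) (simp add: indep prob_space)
  finally show ?thesis .
qed

lemma inv_others_indep: "inv_others i (s(i := a)) = inv_others i s"
  by (simp add: inv_others_def)

text \<open>Multiplied by \<open>prob S\<close>, the \<open>i\<close>-th summand becomes the expectation of
  \<open>indicator S (s i) / hits s\<close>, and these fractions sum to 1 or, without hits, to 0. On average over
  \<open>i\<close> the expectation is therefore at most \<open>1 / (card I * prob S)\<close>, the inverse of the expected number
  of hits.\<close>

lemma sum_expectation_inv_others:
  "(\<Sum>i\<in>I. \<integral>s. inv_others i s \<partial>Q) \<le> 1 / prob S"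
proof -
  have int: "integrable Q (\<lambda>s. indicat_real S (s i) * inv_others i s)" if "i \<in> I" for i
  proof (rule sample.integrable_const_bound[where B=1])
    show "(\<lambda>s. indicat_real S (s i) * inv_others i s) \<in> borel_measurable Q"
      using that by measurable
  qed (use inv_others_bounds in \<open>auto simp: indicator_def\<close>)
  have "prob S * (\<Sum>i\<in>I. \<integral>s. inv_others i s \<partial>Q)
      = (\<Sum>i\<in>I. \<integral>s. indicat_real S (s i) * inv_others i s \<partial>Q)"
    unfolding sum_distrib_left
  proof (intro sum.cong refl)
    fix i assume i: "i \<in> I"
    show "prob S * (\<integral>s. inv_others i s \<partial>Q)
        = (\<integral>s. indicat_real S (s i) * inv_others i s \<partial>Q)"
      by (subst integral_coordinate_times) (use i int inv_others_indep in \<open>auto\<close>)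
  qed
  also have "\<dots> = (\<integral>s. (\<Sum>i\<in>I. indicat_real S (s i) * inv_others i s) \<partial>Q)"
    by (rule Bochner_Integration.integral_sum[symmetric]) (rule int)
  also have "\<dots> \<le> (\<integral>s. 1 \<partial>Q)"
  proof (rule integral_mono)
    fix s
    have "(\<Sum>i\<in>I. indicat_real S (s i) * inv_others i s) = (\<Sum>i\<in>I. indicat_real S (s i) / hits s)"
      by (intro sum.cong refl inv_hits_eq[symmetric]) (auto simp: indicator_def split: if_splits)
    also have "\<dots> = hits s / hits s"
      by (simp add: hits_def flip: sum_divide_distrib)
    also have "\<dots> \<le> 1" by simp
    finally show "(\<Sum>i\<in>I. indicat_real S (s i) * inv_others i s) \<le> 1" .
  qed (use int in auto)
  also have "\<dots> = 1" by (simp add: sample.prob_space)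
  finally show ?thesis using S_pos by (simp add: field_simps)
qed

text \<open>Expanding the square, a mixed term contains \<open>\<phi> (s i)\<close> times a factor that is independent of
  \<open>s i\<close>, hence has expectation 0; a diagonal term is the second moment of \<open>\<phi>\<close> times the expectation of
  \<open>inv_others i\<close>. The weight \<open>1 / hits s\<close>, rather than its square, keeps everything within reach of the
  preceding lemma.\<close>

lemma expectation_sum_square_over_hits:
  fixes \<phi> :: "'a \<Rightarrow> real"
  assumes \<phi>[measurable]: "\<phi> \<in> borel_measurable P" and off: "\<And>a. a \<notin> S \<Longrightarrow> \<phi> a = 0"
    and sq: "integrable P (\<lambda>a. (\<phi> a)\<^sup>2)" and mean: "(\<integral>a. \<phi> a \<partial>P) = 0"
  shows "integrable Q (\<lambda>s. (\<Sum>i\<in>I. \<phi> (s i))\<^sup>2 / hits s)"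
    and "(\<integral>s. (\<Sum>i\<in>I. \<phi> (s i))\<^sup>2 / hits s \<partial>Q) \<le> (\<integral>a. (\<phi> a)\<^sup>2 \<partial>P) / prob S"
proof -
  have \<phi>_int: "integrable P \<phi>" 
    using sq by (rule square_integrable_imp_integrable[OF \<phi>])
  have expand: "(\<Sum>i\<in>I. \<phi> (s i))\<^sup>2 / hits s = (\<Sum>i\<in>I. \<Sum>k\<in>I. \<phi> (s i) * (\<phi> (s k) * inv_others i s))"
    for s
  proof -
    have "(\<Sum>i\<in>I. \<phi> (s i))\<^sup>2 / hits s = (\<Sum>i\<in>I. (\<phi> (s i) / hits s) * (\<Sum>k\<in>I. \<phi> (s k)))"
      by (simp add: power2_eq_square sum_distrib_right sum_divide_distrib)
    also have "\<dots> = (\<Sum>i\<in>I. (\<phi> (s i) * inv_others i s) * (\<Sum>k\<in>I. \<phi> (s k)))"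
      using off by (intro sum.cong refl arg_cong2[where f="(*)"] inv_hits_eq) auto
    finally show ?thesis by (simp add: sum_distrib_left mult_ac)
  qed
  have int: "integrable Q (\<lambda>s. \<phi> (s i) * (\<phi> (s k) * inv_others i s))" if "i \<in> I" "k \<in> I" for i k
  proof (rule Bochner_Integration.integrable_bound)
    show "integrable Q (\<lambda>s. (\<phi> (s i))\<^sup>2 + (\<phi> (s k))\<^sup>2)"
      using that integrable_coordinate[OF _ sq] by auto
    show "(\<lambda>s. \<phi> (s i) * (\<phi> (s k) * inv_others i s)) \<in> borel_measurable Q"
      using that by measurable
    show "AE s in Q. norm (\<phi> (s i) * (\<phi> (s k) * inv_others i s)) \<le> norm ((\<phi> (s i))\<^sup>2 + (\<phi> (s k))\<^sup>2)"
    proof (rule AE_I2)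
      fix s
      have "\<bar>\<phi> (s i) * (\<phi> (s k) * inv_others i s)\<bar> = \<bar>\<phi> (s i) * \<phi> (s k)\<bar> * inv_others i s"
        using inv_others_bounds by (simp add: abs_mult)
      also have "\<dots> \<le> \<bar>\<phi> (s i)\<bar> * \<bar>\<phi> (s k)\<bar>"
        using inv_others_bounds[of i s] by (simp add: mult_left_le abs_mult)
      also have "\<dots> \<le> (\<phi> (s i))\<^sup>2 + (\<phi> (s k))\<^sup>2"
        using sum_squares_bound[of "\<bar>\<phi> (s i)\<bar>" "\<bar>\<phi> (s k)\<bar>"] 
          mult_nonneg_nonneg[of "\<bar>\<phi> (s i)\<bar>" "\<bar>\<phi> (s k)\<bar>"] unfolding power2_abs by linarith
      finally show "norm (\<phi> (s i) * (\<phi> (s k) * inv_others i s)) \<le> norm ((\<phi> (s i))\<^sup>2 + (\<phi> (s k))\<^sup>2)"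
        by simp
    qed
  qed
  show "integrable Q (\<lambda>s. (\<Sum>i\<in>I. \<phi> (s i))\<^sup>2 / hits s)"
    unfolding expand using int by auto
  \<comment> \<open>Integrating over coordinate \<open>i\<close> alone already gives 0, as \<open>\<phi>\<close> has mean zero.\<close>
  have off_diag: "(\<integral>s. \<phi> (s i) * (\<phi> (s k) * inv_others i s) \<partial>Q) = 0"
    if "i \<in> I" "k \<in> I" "k \<noteq> i" for i k
  proof -
    have "integrable Q (\<lambda>s. \<phi> (s k) * inv_others i s)"
    proof (rule Bochner_Integration.integrable_bound)
      show "integrable Q (\<lambda>s. \<phi> (s k))" using that \<phi>_int by (simp add: integrable_coordinate)
      show "(\<lambda>s. \<phi> (s k) * inv_others i s) \<in> borel_measurable Q" using that by measurable
      show "AE s in Q. norm (\<phi> (s k) * inv_others i s) \<le> norm (\<phi> (s k))"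
        using inv_others_bounds by (auto simp: abs_mult mult_left_le)
    qed
    then show ?thesis
      by (subst integral_coordinate_times) (use that int inv_others_indep mean in auto)
  qed
  have diag: "(\<integral>s. \<phi> (s i) * (\<phi> (s i) * inv_others i s) \<partial>Q) 
      = (\<integral>a. (\<phi> a)\<^sup>2 \<partial>P) * (\<integral>s. inv_others i s \<partial>Q)" if "i \<in> I" for i
    using integral_coordinate_times[of i "inv_others i" "\<lambda>a. (\<phi> a)\<^sup>2"] that int[OF that that]
    by (simp add: inv_others_indep power2_eq_square mult.assoc)
  have "(\<integral>s. (\<Sum>i\<in>I. \<phi> (s i))\<^sup>2 / hits s \<partial>Q)
      = (\<Sum>i\<in>I. \<Sum>k\<in>I. \<integral>s. \<phi> (s i) * (\<phi> (s k) * inv_others i s) \<partial>Q)"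
    unfolding expand using int by (subst Bochner_Integration.integral_sum; auto intro!: sum.cong)
  also have "\<dots> = (\<Sum>i\<in>I. (\<integral>a. (\<phi> a)\<^sup>2 \<partial>P) * (\<integral>s. inv_others i s \<partial>Q))"
  proof (intro sum.cong refl)
    fix i assume i: "i \<in> I"
    have "(\<Sum>k\<in>I. \<integral>s. \<phi> (s i) * (\<phi> (s k) * inv_others i s) \<partial>Q)
        = (\<integral>s. \<phi> (s i) * (\<phi> (s i) * inv_others i s) \<partial>Q)"
      using i off_diag finite_I by (subst sum.remove[of _ i]) auto
    then show "(\<Sum>k\<in>I. \<integral>s. \<phi> (s i) * (\<phi> (s k) * inv_others i s) \<partial>Q) 
        = (\<integral>a. (\<phi> a)\<^sup>2 \<partial>P) * (\<integral>s. inv_others i s \<partial>Q)" using diag[OF i] by simp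
  qed
  also have "\<dots> = (\<integral>a. (\<phi> a)\<^sup>2 \<partial>P) * (\<Sum>i\<in>I. \<integral>s. inv_others i s \<partial>Q)"
    by (simp add: sum_distrib_left)
  also have "\<dots> \<le> (\<integral>a. (\<phi> a)\<^sup>2 \<partial>P) * (1 / prob S)"
    by (intro mult_left_mono sum_expectation_inv_others) simp
  finally show "(\<integral>s. (\<Sum>i\<in>I. \<phi> (s i))\<^sup>2 / hits s \<partial>Q) \<le> (\<integral>a. (\<phi> a)\<^sup>2 \<partial>P) / prob S"
    by simp
qed

text \<open>The case without hits uses the default value \<open>0 / 0 = 0\<close>: the average is 0 and the error is
  \<open>\<bar>a\<bar>\<close>. Both this error and the term \<open>1 / (2 \<tau> hits s)\<close> from the arithmetic-geometric mean inequality
  are dominated by \<open>1 / (1 + hits s)\<close>, which lies below the mean of \<open>inv_others i s\<close> over \<open>i\<close>.\<close>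

lemma local_average_error_pointwise:
  fixes k :: "'a \<Rightarrow> real" and a c \<tau> :: real
  assumes "0 < \<tau>"
  defines "\<phi> \<equiv> \<lambda>b. indicat_real S b * (k b - c)"
  shows "\<bar>(\<Sum>i\<in>I. indicat_real S (s i) * k (s i)) / hits s - a\<bar>
      \<le> \<tau> / 2 * ((\<Sum>i\<in>I. \<phi> (s i))\<^sup>2 / hits s) 
        + (1 / \<tau> + \<bar>a\<bar>) / card I * (\<Sum>i\<in>I. inv_others i s) + \<bar>c - a\<bar>"
proof -
  have n: "0 < real (card I)" using finite_I I_nonempty by (simp add: card_gt_0_iff)
  have avg: "1 / (1 + hits s) \<le> (\<Sum>i\<in>I. inv_others i s) / card I"
  proof -
    have "card I * (1 / (1 + hits s)) = (\<Sum>i\<in>I. 1 / (1 + hits s))" by simp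
    also have "\<dots> \<le> (\<Sum>i\<in>I. inv_others i s)"
    proof (rule sum_mono)
      fix i assume i: "i \<in> I"
      have "0 \<le> (\<Sum>k\<in>I - {i}. indicat_real S (s k))" by (intro sum_nonneg) simp
      then show "1 / (1 + hits s) \<le> inv_others i s"
        unfolding inv_others_def hits_split[OF i]
        by (intro divide_left_mono mult_pos_pos) (auto simp: add_nonneg_pos add_pos_nonneg)
    qed
    finally show ?thesis using n by (simp add: field_simps)
  qed
  have sq_nonneg: "0 \<le> (\<Sum>i\<in>I. \<phi> (s i))\<^sup>2 / hits s" using hits_nonneg by simp
  have bound: "(1 / \<tau> + \<bar>a\<bar>) * (1 / (1 + hits s)) \<le> (1 / \<tau> + \<bar>a\<bar>) / card I * (\<Sum>i\<in>I. inv_others i s)"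
    using mult_left_mono[OF avg, of "1 / \<tau> + \<bar>a\<bar>"] assms(1) by simp
  show ?thesis
  proof (cases "hits s = 0")
    case True
    have "\<bar>a\<bar> \<le> (1 / \<tau> + \<bar>a\<bar>) * (1 / (1 + hits s))"
      using True assms(1) by simp
    moreover have "0 \<le> \<bar>c - a\<bar>" by simp
    moreover have "0 \<le> \<tau> / 2 * ((\<Sum>i\<in>I. \<phi> (s i))\<^sup>2 / hits s)"
      using mult_nonneg_nonneg[OF _ sq_nonneg, of "\<tau> / 2"] assms(1) by simp
    ultimately show ?thesis using bound by (simp only: True div_by_0)
  next
    case False
    then have N: "1 \<le> hits s" using hits_zero_or_ge_1 by auto
    define A where "A = (\<Sum>i\<in>I. \<phi> (s i)) / hits s"
    have "(\<Sum>i\<in>I. indicat_real S (s i) * k (s i)) = (\<Sum>i\<in>I. \<phi> (s i)) + c * hits s"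
      unfolding \<phi>_def hits_def sum_distrib_left sum.distrib[symmetric] 
      by (intro sum.cong refl) (simp add: algebra_simps)
    then have "(\<Sum>i\<in>I. indicat_real S (s i) * k (s i)) / hits s - a = A + (c - a)"
      using N by (simp add: A_def field_simps)
    then have "\<bar>(\<Sum>i\<in>I. indicat_real S (s i) * k (s i)) / hits s - a\<bar> \<le> \<bar>A\<bar> + \<bar>c - a\<bar>"
      by simp
    moreover have "\<bar>A\<bar> \<le> \<tau> / 2 * ((\<Sum>i\<in>I. \<phi> (s i))\<^sup>2 / hits s) + 1 / (2 * \<tau> * hits s)"
    proof -
      \<comment> \<open>Arithmetic-geometric mean inequality with the weight \<open>\<tau> * hits s\<close>.\<close>
      have "0 \<le> (\<tau> * hits s * \<bar>A\<bar> - 1)\<^sup>2" by simp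
      then have "2 * \<tau> * hits s * \<bar>A\<bar> \<le> (\<tau> * hits s)\<^sup>2 * A\<^sup>2 + 1"
        by (simp add: power2_diff power_mult_distrib)
      then have "\<bar>A\<bar> \<le> ((\<tau> * hits s)\<^sup>2 * A\<^sup>2 + 1) / (2 * \<tau> * hits s)"
        using N assms(1) by (simp add: pos_le_divide_eq mult_ac)
      also have "\<dots> = \<tau> / 2 * (hits s * A\<^sup>2) + 1 / (2 * \<tau> * hits s)"
        using N assms(1) by (simp add: field_simps power2_eq_square)
      also have "hits s * A\<^sup>2 = (\<Sum>i\<in>I. \<phi> (s i))\<^sup>2 / hits s"
        using N by (simp add: A_def power2_eq_square)
      finally show ?thesis .
    qed
    moreover have "1 / (2 * \<tau> * hits s) \<le> (1 / \<tau> + \<bar>a\<bar>) * (1 / (1 + hits s))"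
    proof -
      have "1 / (2 * \<tau> * hits s) \<le> 1 / (\<tau> * (1 + hits s))"
        using N assms(1) by (intro divide_left_mono mult_pos_pos) (auto simp: algebra_simps)
      also have "\<dots> \<le> (1 / \<tau> + \<bar>a\<bar>) * (1 / (1 + hits s))"
        using N assms(1) by (simp add: add_divide_distrib)
      finally show ?thesis .
    qed
    ultimately show ?thesis using bound by linarith
  qed
qed

text \<open>The constant \<open>c\<close> is the mean of \<open>k\<close> on the cell, so that \<open>indicator S b * (k b - c)\<close> has mean
  zero. With this centring by a single constant, the variation of the conditional mean inside the cell
  is left to the bias term \<open>\<bar>c - a\<bar>\<close>.\<close>

lemma expected_local_average_error:
  fixes k :: "'a \<Rightarrow> real" and a \<tau> :: real
  assumes k[measurable]: "k \<in> borel_measurable P" and \<tau>: "0 < \<tau>"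
    and sq: "integrable P (\<lambda>b. indicat_real S b * (k b)\<^sup>2)"
  defines "c \<equiv> (\<integral>b. indicat_real S b * k b \<partial>P) / prob S"
  shows "(\<integral>\<^sup>+s. ennreal \<bar>(\<Sum>i\<in>I. indicat_real S (s i) * k (s i)) / hits s - a\<bar> \<partial>Q)
      \<le> ennreal (\<tau> / (2 * prob S) * (\<integral>b. indicat_real S b * (k b)\<^sup>2 \<partial>P) 
        + (1 / \<tau> + \<bar>a\<bar>) / (card I * prob S) + \<bar>c - a\<bar>)"
proof -
  define \<phi> where "\<phi> = (\<lambda>b. indicat_real S b * (k b - c))"
  have \<phi>_meas[measurable]: "\<phi> \<in> borel_measurable P" unfolding \<phi>_def by measurable
  have k_int: "integrable P (\<lambda>b. indicat_real S b * k b)"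
  proof (rule square_integrable_imp_integrable)
    have "(\<lambda>b. (indicat_real S b * k b)\<^sup>2) = (\<lambda>b. indicat_real S b * (k b)\<^sup>2)"
      by (auto simp: indicator_def)
    then show "integrable P (\<lambda>b. (indicat_real S b * k b)\<^sup>2)" using sq by simp
  qed auto
  have S_int: "integrable P (indicat_real S)"
    by (rule integrable_const_bound[where B=1]) auto
  have sq_eq: "(\<phi> b)\<^sup>2 = indicat_real S b * (k b)\<^sup>2 - 2 * c * (indicat_real S b * k b) + c\<^sup>2 * indicat_real S b"
    for b by (simp add: \<phi>_def power2_diff indicator_def algebra_simps)
  have \<phi>sq: "integrable P (\<lambda>b. (\<phi> b)\<^sup>2)"
    unfolding sq_eq using sq k_int S_int by auto
  have "(\<integral>b. (\<phi> b)\<^sup>2 \<partial>P) = (\<integral>b. indicat_real S b * (k b)\<^sup>2 \<partial>P) - 2 * c * (c * prob S) + c\<^sup>2 * prob S"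
    unfolding sq_eq using sq k_int S_int S_pos by (simp add: c_def)
  then have \<phi>sq_le: "(\<integral>b. (\<phi> b)\<^sup>2 \<partial>P) \<le> (\<integral>b. indicat_real S b * (k b)\<^sup>2 \<partial>P)"
    using mult_nonneg_nonneg[of "c * c" "prob S"] by (simp add: power2_eq_square mult_ac)
  have mean: "(\<integral>b. \<phi> b \<partial>P) = 0"
  proof -
    have "(\<integral>b. \<phi> b \<partial>P) = (\<integral>b. indicat_real S b * k b - c * indicat_real S b \<partial>P)"
      by (simp add: \<phi>_def algebra_simps)
    also have "\<dots> = (\<integral>b. indicat_real S b * k b \<partial>P) - c * prob S"
      using k_int S_int by simp
    finally show ?thesis using S_pos by (simp add: c_def)
  qed
  note E = expectation_sum_square_over_hits[OF \<phi>_meas _ \<phi>sq mean]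
  have E1: "integrable Q (\<lambda>s. (\<Sum>i\<in>I. \<phi> (s i))\<^sup>2 / hits s)"
    by (rule E) (simp add: \<phi>_def)
  have E2: "(\<integral>s. (\<Sum>i\<in>I. \<phi> (s i))\<^sup>2 / hits s \<partial>Q) \<le> (\<integral>a. (\<phi> a)\<^sup>2 \<partial>P) / prob S"
    by (rule E) (simp add: \<phi>_def)
  let ?R = "\<lambda>s. \<tau> / 2 * ((\<Sum>i\<in>I. \<phi> (s i))\<^sup>2 / hits s) 
        + (1 / \<tau> + \<bar>a\<bar>) / card I * (\<Sum>i\<in>I. inv_others i s) + \<bar>c - a\<bar>"
  have R_int: "integrable Q ?R"
    by (intro Bochner_Integration.integrable_add integrable_mult_right Bochner_Integration.integrable_sum
        integrable_inv_others E1) simp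
  have pw: "\<bar>(\<Sum>i\<in>I. indicat_real S (s i) * k (s i)) / hits s - a\<bar> \<le> ?R s" for s
    using local_average_error_pointwise[OF \<tau>, of s k a c] by (simp add: \<phi>_def)
  have R_nonneg: "0 \<le> ?R s" for s
    using pw[of s] abs_ge_zero order_trans by blast
  have "(\<integral>\<^sup>+s. ennreal \<bar>(\<Sum>i\<in>I. indicat_real S (s i) * k (s i)) / hits s - a\<bar> \<partial>Q)
      \<le> (\<integral>\<^sup>+s. ennreal (?R s) \<partial>Q)"
    by (intro nn_integral_mono ennreal_leI pw)
  also have "\<dots> = ennreal (\<integral>s. ?R s \<partial>Q)"
    by (rule nn_integral_eq_integral) (use R_int R_nonneg in auto)
  also have "(\<integral>s. ?R s \<partial>Q) = \<tau> / 2 * (\<integral>s. (\<Sum>i\<in>I. \<phi> (s i))\<^sup>2 / hits s \<partial>Q)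
        + (1 / \<tau> + \<bar>a\<bar>) / card I * (\<Sum>i\<in>I. \<integral>s. inv_others i s \<partial>Q) + \<bar>c - a\<bar>"
  proof -
    have 1: "integrable Q (\<lambda>s. \<tau> / 2 * ((\<Sum>i\<in>I. \<phi> (s i))\<^sup>2 / hits s))"
      by (rule integrable_mult_right) (rule E1)
    have 2: "integrable Q (\<lambda>s. (1 / \<tau> + \<bar>a\<bar>) / card I * (\<Sum>i\<in>I. inv_others i s))"
      by (intro integrable_mult_right Bochner_Integration.integrable_sum integrable_inv_others)
    have "(\<integral>s. ?R s \<partial>Q) = (\<integral>s. \<tau> / 2 * ((\<Sum>i\<in>I. \<phi> (s i))\<^sup>2 / hits s) \<partial>Q)
        + (\<integral>s. (1 / \<tau> + \<bar>a\<bar>) / card I * (\<Sum>i\<in>I. inv_others i s) \<partial>Q) + \<bar>c - a\<bar>"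
      by (simp only: Bochner_Integration.integral_add[OF Bochner_Integration.integrable_add[OF 1 2]]
          Bochner_Integration.integral_add[OF 1 2] sample.integrable_const) (simp add: sample.prob_space)
    then show ?thesis
      by (simp only: integral_mult_right_zero Bochner_Integration.integral_sum integrable_inv_others)
  qed
  also have "\<dots> \<le> \<tau> / 2 * ((\<integral>b. indicat_real S b * (k b)\<^sup>2 \<partial>P) / prob S)
        + (1 / \<tau> + \<bar>a\<bar>) / card I * (1 / prob S) + \<bar>c - a\<bar>"
    using \<tau> S_pos 
    by (intro add_mono mult_left_mono sum_expectation_inv_others order_trans[OF E2]
        divide_right_mono \<phi>sq_le) auto
  finally show ?thesis by (simp add: ennreal_leI)
qed

end

section \<open>Taylor expansion of a density supported in the cube\<close>

lemma l1_norm_nonneg: "0 \<le> l1_norm x" by (simp add: l1_norm_def sum_nonneg)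

lemma l1_norm_scaleR: "l1_norm (c *\<^sub>R x) = \<bar>c\<bar> * l1_norm x"
  by (simp add: l1_norm_def abs_mult sum_distrib_left)

lemma l1_norm_measurable [measurable]: "l1_norm \<in> borel_measurable borel"
  unfolding l1_norm_def by measurable

lemma strict_floor_bounds:
  assumes "0 < \<beta>" shows "real (strict_floor \<beta>) < \<beta>" "\<beta> \<le> real (strict_floor \<beta>) + 1"
proof -
  have bd: "real k < \<beta> \<Longrightarrow> k \<le> nat \<lceil>\<beta>\<rceil>" for k by linarith
  show "real (strict_floor \<beta>) < \<beta>" unfolding strict_floor_def
    by (rule GreatestI_nat[where k=0 and b="nat \<lceil>\<beta>\<rceil>"]) (use assms bd in auto)
  show "\<beta> \<le> real (strict_floor \<beta>) + 1"
  proof (rule ccontr)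
    assume "\<not> ?thesis"
    then have "real (Suc (strict_floor \<beta>)) < \<beta>" by simp
    then have "Suc (strict_floor \<beta>) \<le> strict_floor \<beta>" 
      unfolding strict_floor_def by (intro Greatest_le_nat[where b="nat \<lceil>\<beta>\<rceil>"]) (use bd in auto)
    then show False by simp
  qed
qed

text \<open>Derivatives are indexed by lists of coordinates instead of multi-indices. Taylor's formula then has
  one term per list, each with the coefficient \<open>1 / fact k\<close> for lists of length \<open>k\<close>.\<close>

definition coord_monomial :: "'d list \<Rightarrow> real ^ 'd \<Rightarrow> real" where
  "coord_monomial is v = (\<Prod>i\<leftarrow>is. v $ i)"

lemma coord_monomial_simps [simp]:
  "coord_monomial [] v = 1" "coord_monomial (i # is) v = v $ i * coord_monomial is v"
  by (simp_all add: coord_monomial_def)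

lemma iterated_partial_simps [simp]:
  "iterated_partial [] f = f" 
  "iterated_partial (i # is) f = partial_deriv i (iterated_partial is f)"
  by (simp_all add: iterated_partial_def)

lemma coord_monomial_measurable [measurable]: "coord_monomial is \<in> borel_measurable borel"
  by (induction "is") (simp_all add: coord_monomial_simps [abs_def])

lemma finite_lists_length: "finite {is :: 'd::finite list. length is = k}"
  using finite_lists_length_eq[of "UNIV :: 'd set" k] by simp

lemma sum_lists_Suc:
  fixes F :: "'d::finite list \<Rightarrow> real"
  shows "(\<Sum>is | length is = Suc k. F is) = (\<Sum>i\<in>UNIV. \<Sum>is | length is = k. F (i # is))"
proof -
  have "{is :: 'd list. length is = Suc k} = (\<lambda>(i, is). i # is) ` (UNIV \<times> {is. length is = k})"
    by (auto simp: image_iff length_Suc_conv)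
  moreover have "inj_on (\<lambda>(i, is). i # is) (UNIV \<times> {is :: 'd list. length is = k})"
    by (auto simp: inj_on_def)
  ultimately have "(\<Sum>is | length is = Suc k. F is) 
      = (\<Sum>(i, is)\<in>UNIV \<times> {is. length is = k}. F (i # is))"
    by (simp add: sum.reindex case_prod_unfold)
  then show ?thesis by (simp add: sum.cartesian_product)
qed

lemma sum_abs_coord_monomial:
  "(\<Sum>is | length is = k. \<bar>coord_monomial is v\<bar>) = l1_norm v ^ k"
proof (induction k)
  case (Suc k)
  have "(\<Sum>is | length is = Suc k. \<bar>coord_monomial is v\<bar>) 
      = (\<Sum>i\<in>UNIV. \<bar>v $ i\<bar> * (\<Sum>is | length is = k. \<bar>coord_monomial is v\<bar>))"
    by (simp add: sum_lists_Suc abs_mult sum_distrib_left)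
  then show ?case by (simp add: Suc l1_norm_def flip: sum_distrib_right)
qed simp

lemma coord_monomial_scaleR: "coord_monomial is (c *\<^sub>R v) = c ^ length is * coord_monomial is v"
  by (induction "is") (auto simp: mult_ac)

lemma abs_coord_monomial_le: "\<bar>coord_monomial is v\<bar> \<le> l1_norm v ^ length is"
proof -
  have "\<bar>coord_monomial is v\<bar> \<le> (\<Sum>js | length js = length is. \<bar>coord_monomial js v\<bar>)"
    by (rule member_le_sum) (auto simp: finite_lists_length)
  then show ?thesis by (simp add: sum_abs_coord_monomial)
qed

text \<open>Translates a list into the multi-index that counts its entries, the form in which the moment
  conditions on the kernel are given.\<close>

lemma coord_monomial_eq_prod:
  "coord_monomial is v = (\<Prod>i\<in>UNIV. v $ i ^ count_list is i)"
proof (induction "is")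
  case (Cons j "is")
  have "(\<Prod>i\<in>UNIV. v $ i ^ count_list (j # is) i) 
      = (\<Prod>i\<in>UNIV. (if i = j then v $ i else 1) * v $ i ^ count_list is i)"
    by (intro prod.cong) auto
  also have "\<dots> = v $ j * (\<Prod>i\<in>UNIV. v $ i ^ count_list is i)"
    by (simp add: prod.distrib)
  finally show ?case by (simp add: Cons)
qed simp

lemma sum_count_list_UNIV: "(\<Sum>i\<in>UNIV. count_list is i) = length (is :: 'd::finite list)"
proof -
  have "(\<Sum>i\<in>UNIV. count_list is i) = (\<Sum>i\<in>set is. count_list is i)"
    by (rule sum.mono_neutral_right) (auto simp: count_list_0_iff)
  then show ?thesis by (simp add: sum_count_set)
qed

lemma iterated_partial_snoc:
  "iterated_partial (is @ [i]) f = iterated_partial is (partial_deriv i f)"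
  by (simp add: iterated_partial_def)

lemma iterated_partial_differentiable:
  "times_differentiable n f \<Longrightarrow> length is < n \<Longrightarrow> iterated_partial is f differentiable (at x)"
proof (induction n arbitrary: f "is")
  case (Suc n)
  show ?case
  proof (cases "is" rule: rev_cases)
    case (snoc js j)
    then show ?thesis using Suc by (simp add: iterated_partial_snoc)
  qed (use Suc in auto)
qed simp

lemma partial_deriv_eq_derivative:
  assumes "(g has_derivative g') (at y)"
  shows "partial_deriv i g y = g' (axis i 1)"
    and "((\<lambda>t. g (y + t *\<^sub>R axis i 1)) has_real_derivative partial_deriv i g y) (at 0)"
proof -
  have "((\<lambda>t. g (y + t *\<^sub>R axis i 1)) has_derivative (\<lambda>t. g' (t *\<^sub>R axis i 1))) (at 0)"
    by (rule has_derivative_compose[where g=g and g'=g' and f="\<lambda>t. y + t *\<^sub>R axis i 1", simplified])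
      (use assms in \<open>auto intro!: derivative_eq_intros\<close>)
  moreover have "(\<lambda>t. g' (t *\<^sub>R axis i 1)) = (*) (g' (axis i 1))"
    using has_derivative_bounded_linear[OF assms]
    by (auto simp: linear_simps bounded_linear.linear linear_scale)
  ultimately have D: "((\<lambda>t. g (y + t *\<^sub>R axis i 1)) has_real_derivative g' (axis i 1)) (at 0)"
    by (simp add: has_field_derivative_def)
  then show "partial_deriv i g y = g' (axis i 1)" 
    unfolding partial_deriv_def by (rule DERIV_imp_deriv)
  with D show "((\<lambda>t. g (y + t *\<^sub>R axis i 1)) has_real_derivative partial_deriv i g y) (at 0)"
    by simp
qed

lemma has_real_derivative_along_line:
  fixes g :: "real ^ 'd \<Rightarrow> real"
  assumes "g differentiable (at (x + t *\<^sub>R v))"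
  shows "((\<lambda>t. g (x + t *\<^sub>R v)) has_real_derivative (\<Sum>i\<in>UNIV. v $ i * partial_deriv i g (x + t *\<^sub>R v))) (at t)"
proof -
  obtain g' where g': "(g has_derivative g') (at (x + t *\<^sub>R v))"
    using assms by (auto simp: differentiable_def)
  have lin: "linear g'" using g' has_derivative_linear by blast
  have "((\<lambda>t. g (x + t *\<^sub>R v)) has_derivative (\<lambda>s. g' (s *\<^sub>R v))) (at t)"
    by (rule has_derivative_compose[where g=g and g'=g' and f="\<lambda>t. x + t *\<^sub>R v"])
      (use g' in \<open>auto intro!: derivative_eq_intros\<close>)
  moreover have "(\<lambda>s. g' (s *\<^sub>R v)) = (*) (\<Sum>i\<in>UNIV. v $ i * partial_deriv i g (x + t *\<^sub>R v))"
  proof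
    fix s
    have "g' v = g' (\<Sum>i\<in>UNIV. v $ i *\<^sub>R axis i 1)"
      using basis_expansion[of v] by (simp add: scalar_mult_eq_scaleR)
    also have "\<dots> = (\<Sum>i\<in>UNIV. v $ i * g' (axis i 1))"
      by (simp add: linear_sum[OF lin] linear_scale[OF lin])
    finally show "g' (s *\<^sub>R v) = (\<Sum>i\<in>UNIV. v $ i * partial_deriv i g (x + t *\<^sub>R v)) * s"
      by (simp add: linear_scale[OF lin] partial_deriv_eq_derivative(1)[OF g'])
  qed
  ultimately show ?thesis by (simp add: has_field_derivative_def)
qed

text \<open>One-dimensional Taylor expansion of \<open>t \<mapsto> f (x + t v)\<close>: differentiating along \<open>v\<close> prepends one more
  coordinate to every list.\<close>

lemma taylor_lists:
  fixes f :: "real ^ 'd \<Rightarrow> real"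
  assumes f: "times_differentiable l f" and l: "0 < l"
  obtains \<theta> where "0 < \<theta>" "\<theta> < 1"
    "f (x + v) = (\<Sum>k<l. (\<Sum>is | length is = k. coord_monomial is v * iterated_partial is f x) / fact k)
       + (\<Sum>is | length is = l. coord_monomial is v * iterated_partial is f (x + \<theta> *\<^sub>R v)) / fact l"
proof -
  define D where "D k t = (\<Sum>is | length is = k. coord_monomial is v * iterated_partial is f (x + t *\<^sub>R v))"
    for k t
  have "DERIV (D k) t :> D (Suc k) t" if "k < l" for k t
  proof -
    have "DERIV (D k) t :> (\<Sum>is | length is = k. coord_monomial is v * 
        (\<Sum>i\<in>UNIV. v $ i * partial_deriv i (iterated_partial is f) (x + t *\<^sub>R v)))"
      unfolding D_def[abs_def] 
      by (intro DERIV_sum DERIV_cmult has_real_derivative_along_line iterated_partial_differentiable[OF f])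
        (use that in auto)
    also have "(\<Sum>is | length is = k. coord_monomial is v * 
        (\<Sum>i\<in>UNIV. v $ i * partial_deriv i (iterated_partial is f) (x + t *\<^sub>R v))) = D (Suc k) t"
      unfolding D_def sum_lists_Suc sum_distrib_left
      by (subst sum.swap) (simp add: mult_ac)
    finally show ?thesis .
  qed
  then obtain \<theta> where "0 < \<theta>" "\<theta> < 1" 
    "D 0 1 = (\<Sum>m<l. D m 0 / fact m * 1 ^ m) + D l \<theta> / fact l * 1 ^ l"
    using Maclaurin[of 1 l D "D 0"] l by auto
  then show ?thesis by (intro that[of \<theta>]) (auto simp: D_def)
qed

abbreviation off_open_cube :: "(real ^ 'd) set" where
  "off_open_cube \<equiv> {y. \<exists>j. y $ j \<le> 0 \<or> 1 \<le> y $ j}"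

text \<open>If the coordinate \<open>j\<close> violates \<open>0 < y $ j < 1\<close>, then moving in the direction \<open>\<sigma>\<close> (downwards if
  \<open>y $ j \<le> 0\<close>, upwards otherwise) along any axis does not repair this, and moving along the axis \<open>j\<close>
  leaves the closed cube at once. One-sided limits along such rays give values and derivatives at the
  boundary.\<close>

lemma off_open_cube_ray:
  assumes "y \<in> off_open_cube"
  obtains \<sigma> :: real where "\<sigma> \<noteq> 0" "\<And>i t. 0 \<le> t \<Longrightarrow> y + (\<sigma> * t) *\<^sub>R axis i 1 \<in> off_open_cube"
    "\<exists>i. \<forall>t>0. y + (\<sigma> * t) *\<^sub>R axis i 1 \<notin> unit_cube"
proof -
  from assms obtain j where "y $ j \<le> 0 \<or> 1 \<le> y $ j" by auto
  then show ?thesis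
  proof
    assume j: "y $ j \<le> 0"
    show ?thesis
    proof (rule that[of "-1"])
      show "y + (- 1 * t) *\<^sub>R axis i 1 \<in> off_open_cube" if "0 \<le> t" for i t
        using j that by (auto intro!: exI[of _ j] simp: axis_def)
      show "\<exists>i. \<forall>t>0. y + (- 1 * t) *\<^sub>R axis i 1 \<notin> unit_cube"
        using j by (intro exI[of _ j]) (auto simp: mem_box_cart intro!: exI[of _ j])
    qed simp
  next
    assume j: "1 \<le> y $ j"
    show ?thesis
    proof (rule that[of 1])
      show "y + (1 * t) *\<^sub>R axis i 1 \<in> off_open_cube" if "0 \<le> t" for i t
        using j that by (auto intro!: exI[of _ j] simp: axis_def)
      show "\<exists>i. \<forall>t>0. y + (1 * t) *\<^sub>R axis i 1 \<notin> unit_cube"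
        using j by (intro exI[of _ j]) (auto simp: mem_box_cart intro!: exI[of _ j])
    qed simp
  qed
qed

lemma vanishes_off_open_cube:
  fixes f :: "real ^ 'd \<Rightarrow> real"
  assumes cont: "isCont f y" and off: "\<And>x. x \<notin> unit_cube \<Longrightarrow> f x = 0"
    and y: "y \<in> off_open_cube"
  shows "f y = 0"
proof -
  obtain \<sigma> i where ray: "\<forall>t>0. y + (\<sigma> * t) *\<^sub>R axis i 1 \<notin> unit_cube"
    using off_open_cube_ray[OF y] by metis
  have "((\<lambda>t. f (y + (\<sigma> * t) *\<^sub>R axis i 1)) \<longlongrightarrow> f (y + (\<sigma> * 0) *\<^sub>R axis i 1)) (at_right 0)"
    by (rule isCont_tendsto_compose[of _ f]) (use cont in \<open>auto intro!: tendsto_eq_intros\<close>)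
  moreover have "eventually (\<lambda>t. f (y + (\<sigma> * t) *\<^sub>R axis i 1) = 0) (at_right 0)"
    using ray off by (auto simp: eventually_at_right_field intro!: exI[of _ 1])
  ultimately have "((\<lambda>t. 0) \<longlongrightarrow> f y) (at_right (0::real))"
    by (subst (asm) tendsto_cong) auto
  then show ?thesis by (simp add: tendsto_const_iff)
qed

lemma partial_deriv_vanishes_off_open_cube:
  fixes g :: "real ^ 'd \<Rightarrow> real"
  assumes diff: "g differentiable (at y)" and off: "\<And>x. x \<in> off_open_cube \<Longrightarrow> g x = 0"
    and y: "y \<in> off_open_cube"
  shows "partial_deriv i g y = 0"
proof -
  obtain \<sigma> :: real where \<sigma>: "\<sigma> \<noteq> 0" and 
    ray: "\<And>t. 0 \<le> t \<Longrightarrow> y + (\<sigma> * t) *\<^sub>R axis i 1 \<in> off_open_cube"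
    by (rule off_open_cube_ray[OF y]) (rule that; blast)
  obtain g' where "(g has_derivative g') (at y)" using diff by (auto simp: differentiable_def)
  then have "((\<lambda>t. g (y + t *\<^sub>R axis i 1)) has_real_derivative partial_deriv i g y) (at (\<sigma> * 0))"
    using partial_deriv_eq_derivative(2) by simp
  then have "((\<lambda>t. g (y + (\<sigma> * t) *\<^sub>R axis i 1)) has_real_derivative partial_deriv i g y * \<sigma>) (at 0)"
    by (rule DERIV_chain2) (auto intro!: derivative_eq_intros)
  then have "((\<lambda>t. (g (y + (\<sigma> * t) *\<^sub>R axis i 1) - g y) / t) \<longlongrightarrow> partial_deriv i g y * \<sigma>) (at_right 0)"
    unfolding DERIV_def by (auto intro: filterlim_mono[OF _ _ at_le])
  moreover have "eventually (\<lambda>t. (g (y + (\<sigma> * t) *\<^sub>R axis i 1) - g y) / t = 0) (at_right 0)"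
    using ray off y by (auto simp: eventually_at_right_field intro!: exI[of _ 1])
  ultimately have "((\<lambda>t. 0) \<longlongrightarrow> partial_deriv i g y * \<sigma>) (at_right (0::real))"
    by (subst (asm) tendsto_cong) auto
  then show ?thesis using \<sigma> by (simp add: tendsto_const_iff)
qed

text \<open>Each partial derivative is the limit of difference quotients along a ray on which the previous
  derivative is identically zero.\<close>

lemma iterated_partial_vanishes_off_open_cube:
  fixes f :: "real ^ 'd \<Rightarrow> real"
  assumes f: "times_differentiable l f" and l: "0 < l" and off: "\<And>x. x \<notin> unit_cube \<Longrightarrow> f x = 0"
  shows "length is \<le> l \<Longrightarrow> y \<in> off_open_cube \<Longrightarrow> iterated_partial is f y = 0"
proof (induction "is" arbitrary: y)
  case Nil
  have "f differentiable (at y)" using iterated_partial_differentiable[OF f, of "[]"] l by simp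
  then have "isCont f y" by (rule differentiable_imp_continuous_within)
  then show ?case using vanishes_off_open_cube[OF _ off] Nil by simp
next
  case (Cons i "is")
  then show ?case
    using partial_deriv_vanishes_off_open_cube[of "iterated_partial is f" y i]
      iterated_partial_differentiable[OF f, of "is" y] by simp
qed

text \<open>If \<open>y\<close> is outside the cube, the segment from \<open>x\<close> to \<open>y\<close> crosses the boundary at some \<open>b\<close>. The
  derivative vanishes at \<open>b\<close> and at \<open>y\<close>, so \<open>y\<close> may be replaced by \<open>b\<close>, which is no farther from \<open>x\<close>.\<close>

lemma iterated_partial_holder_everywhere:
  fixes f :: "real ^ 'd \<Rightarrow> real"
  assumes f: "times_differentiable l f" and l: "0 < l" and off: "\<And>x. x \<notin> unit_cube \<Longrightarrow> f x = 0"
    and W: "0 \<le> W" and e: "0 \<le> e" and len: "length is = l"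
    and holder: "\<And>x x'. x \<in> unit_cube \<Longrightarrow> x' \<in> unit_cube \<Longrightarrow> 
      \<bar>iterated_partial is f x - iterated_partial is f x'\<bar> \<le> W * l1_norm (x - x') powr e"
    and x: "x \<in> unit_cube"
  shows "\<bar>iterated_partial is f y - iterated_partial is f x\<bar> \<le> W * l1_norm (y - x) powr e"
proof (cases "y \<in> unit_cube")
  case True
  then show ?thesis using holder x by blast
next
  case False
  have van: "iterated_partial is f z = 0" if "z \<in> off_open_cube" for z
    using iterated_partial_vanishes_off_open_cube[OF f l off _ that] len by simp
  have "closed_segment x y \<inter> frontier unit_cube \<noteq> {}"
    by (rule connected_Int_frontier) (use False x in auto)
  then obtain b where b: "b \<in> closed_segment x y" "b \<in> unit_cube" "b \<notin> box 0 1"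
    by (auto simp: frontier_cbox)
  from b(3) have "b \<in> off_open_cube" by (auto simp: mem_box_cart not_less)
  moreover have "y \<in> off_open_cube" using False by (auto simp: mem_box_cart not_le intro: less_imp_le)
  ultimately have "\<bar>iterated_partial is f y - iterated_partial is f x\<bar> 
      = \<bar>iterated_partial is f b - iterated_partial is f x\<bar>" using van by simp
  also have "\<dots> \<le> W * l1_norm (b - x) powr e" using holder b x by blast
  also have "\<dots> \<le> W * l1_norm (y - x) powr e"
  proof -
    obtain u where u: "0 \<le> u" "u \<le> 1" "b - x = u *\<^sub>R (y - x)"
      using b(1) by (auto simp: in_segment algebra_simps)
    then have "l1_norm (b - x) \<le> l1_norm (y - x)"
      by (simp add: l1_norm_scaleR l1_norm_nonneg mult_left_le_one_le)
    then show ?thesis using W e by (intro mult_left_mono powr_mono2) (auto simp: l1_norm_nonneg)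
  qed
  finally show ?thesis .
qed

text \<open>The Lagrange remainder differs from the Taylor term of order \<open>l\<close> by increments of derivatives of
  order \<open>l\<close>, to which the Hoelder condition applies.\<close>

lemma taylor_remainder_bound:
  fixes f :: "real ^ 'd \<Rightarrow> real"
  assumes f: "times_differentiable l f" and l: "0 < l" and off: "\<And>x. x \<notin> unit_cube \<Longrightarrow> f x = 0"
    and W: "0 \<le> W" and \<beta>: "real l \<le> \<beta>"
    and holder: "\<And>is x x'. length is = l \<Longrightarrow> x \<in> unit_cube \<Longrightarrow> x' \<in> unit_cube \<Longrightarrow> 
      \<bar>iterated_partial is f x - iterated_partial is f x'\<bar> \<le> W * l1_norm (x - x') powr (\<beta> - real l)"
    and x: "x \<in> unit_cube"
  shows "\<bar>f (x + v) - (\<Sum>k\<le>l. (\<Sum>is | length is = k. coord_monomial is v * iterated_partial is f x) / fact k)\<bar>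
    \<le> W * l1_norm v powr \<beta>"
proof (cases "v = 0")
  case True
  have "(\<Sum>k\<le>l. (\<Sum>is | length is = k. coord_monomial is v * iterated_partial is f x) / fact k) 
      = (\<Sum>k\<in>{0}. (\<Sum>is | length is = k. coord_monomial is v * iterated_partial is f x) / fact k)"
    by (rule sum.mono_neutral_right) (auto simp: True length_Suc_conv neq_Nil_conv coord_monomial_def intro!: sum.neutral)
  then show ?thesis using W by (simp add: True)
next
  case False
  then have v: "0 < l1_norm v"
    by (auto simp: l1_norm_def vec_eq_iff intro!: sum_pos2)
  obtain \<theta> where \<theta>: "0 < \<theta>" "\<theta> < 1" and eq:
    "f (x + v) = (\<Sum>k<l. (\<Sum>is | length is = k. coord_monomial is v * iterated_partial is f x) / fact k)
       + (\<Sum>is | length is = l. coord_monomial is v * iterated_partial is f (x + \<theta> *\<^sub>R v)) / fact l"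
    by (rule taylor_lists[OF f l])
  have "f (x + v) - (\<Sum>k\<le>l. (\<Sum>is | length is = k. coord_monomial is v * iterated_partial is f x) / fact k)
      = (\<Sum>is | length is = l. coord_monomial is v * 
          (iterated_partial is f (x + \<theta> *\<^sub>R v) - iterated_partial is f x)) / fact l"
    unfolding eq lessThan_Suc_atMost[symmetric]
    by (simp add: right_diff_distrib sum_subtractf diff_divide_distrib)
  also have "\<bar>\<dots>\<bar> \<le> \<bar>\<Sum>is | length is = l. coord_monomial is v * 
          (iterated_partial is f (x + \<theta> *\<^sub>R v) - iterated_partial is f x)\<bar>"
    using divide_left_mono[of 1 "fact l :: real"] by (simp add: abs_divide divide_le_eq mult_le_cancel_left1)
  also have "\<dots> \<le> (\<Sum>is | length is = l. \<bar>coord_monomial is v\<bar> * (W * l1_norm v powr (\<beta> - real l)))"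
  proof (rule order_trans[OF sum_abs], rule sum_mono, unfold abs_mult, intro mult_left_mono)
    fix "is" :: "'d list" assume "is \<in> {is. length is = l}"
    then have len: "length is = l" by simp
    have "\<bar>iterated_partial is f (x + \<theta> *\<^sub>R v) - iterated_partial is f x\<bar> 
        \<le> W * l1_norm (x + \<theta> *\<^sub>R v - x) powr (\<beta> - real l)"
      by (rule iterated_partial_holder_everywhere[OF f l off W _ len holder[OF len] x]) (use \<beta> in auto)
    also have "\<dots> \<le> W * l1_norm v powr (\<beta> - real l)"
      using W \<beta> \<theta> v by (intro mult_left_mono powr_mono2) (auto simp: l1_norm_scaleR)
    finally show "\<bar>iterated_partial is f (x + \<theta> *\<^sub>R v) - iterated_partial is f x\<bar> 
        \<le> W * l1_norm v powr (\<beta> - real l)" .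
  qed simp
  also have "\<dots> = W * (l1_norm v ^ l * l1_norm v powr (\<beta> - real l))"
    by (simp add: sum_abs_coord_monomial flip: sum_distrib_right)
  also have "l1_norm v ^ l * l1_norm v powr (\<beta> - real l) = l1_norm v powr \<beta>"
    using v by (simp add: powr_realpow[symmetric] flip: powr_add)
  finally show ?thesis .
qed

section \<open>Bias of kernel smoothing\<close>

text \<open>Needed because \<open>0 powr 0 = 0\<close>: off this null set a factor \<open>\<bar>u $ j\<bar> powr 0\<close> equals 1.\<close>

lemma AE_all_coordinates_nonzero:
  "AE u in lborel. \<forall>i. (u :: real ^ 'd) $ i \<noteq> 0"
proof -
  have "AE u in lborel. (u :: real ^ 'd) $ i \<noteq> 0" for i
  proof -
    have "negligible {u :: real ^ 'd. u \<bullet> axis i 1 = 0}"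
      by (rule negligible_standard_hyperplane) (simp add: axis_in_Basis_iff)
    moreover have "{u :: real ^ 'd. u \<bullet> axis i 1 = 0} = {u. u $ i = 0}"
      by (simp add: inner_axis)
    moreover have "{u :: real ^ 'd. u $ i = 0} \<in> sets lborel" by measurable
    ultimately have "{u :: real ^ 'd. u $ i = 0} \<in> null_sets lborel"
      by (simp add: negligible_iff_null_sets null_sets_completion_iff)
    then show ?thesis by (rule AE_I') auto
  qed
  then show ?thesis by (simp add: AE_all_countable)
qed

definition kernel_abs_moment :: "real \<Rightarrow> (real ^ 'd \<Rightarrow> real) \<Rightarrow> real" where
  "kernel_abs_moment \<beta> K = (\<integral>u. \<bar>K u\<bar> * l1_norm u powr \<beta> \<partial>lborel)"

lemma l1_norm_powr_le_sum:
  fixes u :: "real ^ 'd"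
  assumes "0 \<le> \<beta>"
  shows "l1_norm u powr \<beta> \<le> real CARD('d) powr \<beta> * (\<Sum>i\<in>UNIV. \<bar>u $ i\<bar> powr \<beta>)"
proof -
  have "Max (range (\<lambda>i. \<bar>u $ i\<bar>)) \<in> range (\<lambda>i. \<bar>u $ i\<bar>)"
    by (rule Max_in) auto
  then obtain i where i: "\<bar>u $ i\<bar> = Max (range (\<lambda>i. \<bar>u $ i\<bar>))" by (metis imageE)
  have "l1_norm u \<le> (\<Sum>j\<in>(UNIV :: 'd set). \<bar>u $ i\<bar>)"
    unfolding l1_norm_def by (intro sum_mono) (simp add: i)
  then have "l1_norm u powr \<beta> \<le> (real CARD('d) * \<bar>u $ i\<bar>) powr \<beta>"
    using assms by (intro powr_mono2) (auto simp: l1_norm_nonneg)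
  also have "\<dots> = real CARD('d) powr \<beta> * \<bar>u $ i\<bar> powr \<beta>" by (simp add: powr_mult)
  also have "\<dots> \<le> real CARD('d) powr \<beta> * (\<Sum>i\<in>UNIV. \<bar>u $ i\<bar> powr \<beta>)"
    by (intro mult_left_mono member_le_sum) auto
  finally show ?thesis .
qed

context
  fixes \<beta> :: real and K :: "real ^ 'd \<Rightarrow> real"
  assumes \<beta>: "0 < \<beta>" and K: "appropriate_kernel \<beta> K"
begin

lemma kernel_measurable [measurable]: "K \<in> borel_measurable borel"
  using K by (auto simp: appropriate_kernel_def dest: borel_measurable_integrable)

lemma integrable_kernel: "integrable lborel K"
  using K by (simp add: appropriate_kernel_def)

lemma integrable_kernel_moment: "integrable lborel (\<lambda>u. \<bar>K u\<bar> * l1_norm u powr \<beta>)"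
proof (rule Bochner_Integration.integrable_bound)
  have "integrable lborel (\<lambda>u. \<bar>K u\<bar> * \<bar>u $ i\<bar> powr \<beta>)" for i
  proof -
    let ?\<alpha> = "\<lambda>j. if j = i then \<beta> else 0"
    have "integrable lborel (\<lambda>u. \<bar>K u\<bar> * (\<Prod>j\<in>UNIV. \<bar>u $ j\<bar> powr ?\<alpha> j))"
      using K \<beta> unfolding appropriate_kernel_def 
      by (elim conjE allE[of _ ?\<alpha>] impE) auto
    moreover have "(\<Prod>j\<in>UNIV. \<bar>u $ j\<bar> powr ?\<alpha> j) = \<bar>u $ i\<bar> powr \<beta>" if "\<forall>j. u $ j \<noteq> 0" for u :: "real ^ 'd"
    proof -
      have "(\<Prod>j\<in>UNIV. \<bar>u $ j\<bar> powr ?\<alpha> j) = (\<Prod>j\<in>UNIV. if j = i then \<bar>u $ i\<bar> powr \<beta> else 1)"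
        using that by (intro prod.cong) auto
      then show ?thesis by simp
    qed
    then have "AE u in lborel. \<bar>K u\<bar> * (\<Prod>j\<in>UNIV. \<bar>u $ j\<bar> powr ?\<alpha> j) = \<bar>K u\<bar> * \<bar>u $ i\<bar> powr \<beta>"
      using AE_all_coordinates_nonzero by (auto elim!: eventually_mono)
    ultimately show ?thesis
      by (subst (asm) integrable_cong_AE) auto
  qed
  then show "integrable lborel (\<lambda>u. real CARD('d) powr \<beta> * (\<Sum>i\<in>UNIV. \<bar>K u\<bar> * \<bar>u $ i\<bar> powr \<beta>))"
    by auto
  show "AE u in lborel. norm (\<bar>K u\<bar> * l1_norm u powr \<beta>) 
      \<le> norm (real CARD('d) powr \<beta> * (\<Sum>i\<in>UNIV. \<bar>K u\<bar> * \<bar>u $ i\<bar> powr \<beta>))"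
  proof (rule AE_I2)
    fix u :: "real ^ 'd"
    show "norm (\<bar>K u\<bar> * l1_norm u powr \<beta>) 
      \<le> norm (real CARD('d) powr \<beta> * (\<Sum>i\<in>UNIV. \<bar>K u\<bar> * \<bar>u $ i\<bar> powr \<beta>))"
      using mult_left_mono[OF l1_norm_powr_le_sum[of \<beta> u], of "\<bar>K u\<bar>"] \<beta>
      by (simp add: sum_nonneg abs_mult mult_ac flip: sum_distrib_left)
  qed
qed measurable

lemma kernel_abs_moment_nonneg: "0 \<le> kernel_abs_moment \<beta> K"
  unfolding kernel_abs_moment_def by simp

lemma integrable_kernel_monomial:
  assumes "length is \<le> strict_floor \<beta>"
  shows "integrable lborel (\<lambda>u. coord_monomial is u * K u)"
proof (rule Bochner_Integration.integrable_bound)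
  show "integrable lborel (\<lambda>u. \<bar>K u\<bar> + \<bar>K u\<bar> * l1_norm u powr \<beta>)"
    using integrable_kernel integrable_kernel_moment by auto
  show "AE u in lborel. norm (coord_monomial is u * K u) \<le> norm (\<bar>K u\<bar> + \<bar>K u\<bar> * l1_norm u powr \<beta>)"
  proof (rule AE_I2)
    fix u :: "real ^ 'd"
    have len: "real (length is) \<le> \<beta>" using assms strict_floor_bounds(1)[OF \<beta>] by linarith
    have "l1_norm u ^ length is \<le> 1 + l1_norm u powr \<beta>"
    proof (cases "l1_norm u \<le> 1")
      case True
      then have "l1_norm u ^ length is \<le> 1" by (simp add: power_le_one l1_norm_nonneg)
      moreover have "0 \<le> l1_norm u powr \<beta>" by simp
      ultimately show ?thesis by linarith
    next
      case False
      then have "l1_norm u ^ length is = l1_norm u powr length is"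
        by (simp add: powr_realpow)
      also have "\<dots> \<le> l1_norm u powr \<beta>" using False len by (intro powr_mono) auto
      finally show ?thesis by simp
    qed
    with abs_coord_monomial_le[of "is" u] have "\<bar>coord_monomial is u\<bar> \<le> 1 + l1_norm u powr \<beta>" by linarith
    then have "\<bar>coord_monomial is u\<bar> * \<bar>K u\<bar> \<le> (1 + l1_norm u powr \<beta>) * \<bar>K u\<bar>"
      by (rule mult_right_mono) simp
    then show "norm (coord_monomial is u * K u) \<le> norm (\<bar>K u\<bar> + \<bar>K u\<bar> * l1_norm u powr \<beta>)"
      by (simp add: abs_mult algebra_simps)
  qed
qed measurable

lemma kernel_monomial_integral:
  assumes "1 \<le> length is" "length is \<le> strict_floor \<beta>"
  shows "(\<integral>u. coord_monomial is u * K u \<partial>lborel) = 0"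
proof -
  have "(\<integral>u. (\<Prod>i\<in>UNIV. u $ i ^ count_list is i) * K u \<partial>lborel) = 0"
    using K assms unfolding appropriate_kernel_def
    by (elim conjE allE[of _ "count_list is"] impE) (simp_all add: sum_count_list_UNIV)
  then show ?thesis by (simp add: coord_monomial_eq_prod)
qed

text \<open>The vanishing moments reduce the integral of \<open>K\<close> against a Taylor polynomial to the term of
  degree 0.\<close>

lemma kernel_taylor_polynomial:
  fixes D :: "'d list \<Rightarrow> real" and h :: real
  defines "T \<equiv> \<lambda>v. \<Sum>k\<le>strict_floor \<beta>. (\<Sum>is | length is = k. coord_monomial is v * D is) / fact k"
  shows "integrable lborel (\<lambda>u. K u * T (h *\<^sub>R u))"
    and "(\<integral>u. K u * T (h *\<^sub>R u) \<partial>lborel) = D []"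
proof -
  have eq: "K u * T (h *\<^sub>R u) = (\<Sum>k\<le>strict_floor \<beta>. \<Sum>is | length is = k. 
      (h ^ k * D is / fact k) * (coord_monomial is u * K u))" for u
    unfolding T_def sum_distrib_left sum_divide_distrib
    by (intro sum.cong refl) (auto simp: coord_monomial_scaleR)
  show "integrable lborel (\<lambda>u. K u * T (h *\<^sub>R u))"
    unfolding eq by (intro Bochner_Integration.integrable_sum integrable_mult_right integrable_kernel_monomial) auto
  have "(\<integral>u. K u * T (h *\<^sub>R u) \<partial>lborel) = (\<Sum>k\<le>strict_floor \<beta>. \<Sum>is | length is = k. 
      (h ^ k * D is / fact k) * (\<integral>u. coord_monomial is u * K u \<partial>lborel))"
    unfolding eq
    by (subst Bochner_Integration.integral_sum, 
        (intro Bochner_Integration.integrable_sum integrable_mult_right integrable_kernel_monomial; auto),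
        intro sum.cong refl, subst Bochner_Integration.integral_sum, 
        intro integrable_mult_right integrable_kernel_monomial) auto
  also have "\<dots> = (\<Sum>k\<in>{0}. \<Sum>is | length is = k. 
      (h ^ k * D is / fact k) * (\<integral>u. coord_monomial is u * K u \<partial>lborel))"
    by (rule sum.mono_neutral_right) (auto intro!: sum.neutral simp: kernel_monomial_integral Suc_le_eq)
  also have "\<dots> = D []"
    using K by (simp add: appropriate_kernel_def)
  finally show "(\<integral>u. K u * T (h *\<^sub>R u) \<partial>lborel) = D []" .
qed

lemma kernel_bias_pointwise:
  fixes f :: "real ^ 'd \<Rightarrow> real"
  assumes h: "0 < h" and W: "0 \<le> W"
    and f[measurable]: "f \<in> borel_measurable borel"
    and rem: "\<And>v. \<bar>f (x + v) - (\<Sum>k\<le>strict_floor \<beta>. (\<Sum>is | length is = k. coord_monomial is v * iterated_partial is f x) / fact k)\<bar>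
    \<le> W * l1_norm v powr \<beta>"
  shows "\<bar>(\<integral>u. K u * f (x + h *\<^sub>R u) \<partial>lborel) - f x\<bar> \<le> W * h powr \<beta> * kernel_abs_moment \<beta> K"
proof -
  define T where "T = (\<lambda>v. \<Sum>k\<le>strict_floor \<beta>. (\<Sum>is | length is = k. coord_monomial is v * iterated_partial is f x) / fact k)"
  have T_meas[measurable]: "T \<in> borel_measurable borel" unfolding T_def by measurable
  have T: "integrable lborel (\<lambda>u. K u * T (h *\<^sub>R u))" "(\<integral>u. K u * T (h *\<^sub>R u) \<partial>lborel) = f x"
    using kernel_taylor_polynomial[where D="\<lambda>is. iterated_partial is f x" and h=h] by (simp_all add: T_def)
  define R where "R = (\<lambda>u. K u * (f (x + h *\<^sub>R u) - T (h *\<^sub>R u)))"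
  have R_le: "\<bar>R u\<bar> \<le> W * h powr \<beta> * (\<bar>K u\<bar> * l1_norm u powr \<beta>)" for u
  proof -
    have "\<bar>f (x + h *\<^sub>R u) - T (h *\<^sub>R u)\<bar> \<le> W * l1_norm (h *\<^sub>R u) powr \<beta>"
      unfolding T_def by (rule rem)
    also have "l1_norm (h *\<^sub>R u) powr \<beta> = h powr \<beta> * l1_norm u powr \<beta>"
      using h by (simp add: l1_norm_scaleR powr_mult l1_norm_nonneg)
    finally show ?thesis
      unfolding R_def abs_mult by (rule mult_left_mono[THEN order_trans]) (simp_all add: mult_ac)
  qed
  \<comment> \<open>The bias is the integral of \<open>R\<close>, since the Taylor polynomial integrates to \<open>f x\<close>.\<close>
  have bound_int: "integrable lborel (\<lambda>u. W * h powr \<beta> * (\<bar>K u\<bar> * l1_norm u powr \<beta>))"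
    using integrable_kernel_moment by auto
  have R_int: "integrable lborel R"
  proof (rule Bochner_Integration.integrable_bound[OF bound_int])
    show "R \<in> borel_measurable lborel" unfolding R_def by measurable
    show "AE u in lborel. norm (R u) \<le> norm (W * h powr \<beta> * (\<bar>K u\<bar> * l1_norm u powr \<beta>))"
      using R_le W by (auto simp: abs_mult)
  qed
  have "(\<lambda>u. K u * f (x + h *\<^sub>R u)) = (\<lambda>u. K u * T (h *\<^sub>R u) + R u)"
    by (auto simp: R_def algebra_simps)
  then have "(\<integral>u. K u * f (x + h *\<^sub>R u) \<partial>lborel) - f x = (\<integral>u. R u \<partial>lborel)"
    using T R_int by simp
  also have "\<bar>\<dots>\<bar> \<le> (\<integral>u. \<bar>R u\<bar> \<partial>lborel)" using integral_norm_bound[of lborel R] by simp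
  also have "\<dots> \<le> (\<integral>u. W * h powr \<beta> * (\<bar>K u\<bar> * l1_norm u powr \<beta>) \<partial>lborel)"
    by (rule integral_mono) (use R_int bound_int R_le in auto)
  finally show ?thesis by (simp add: kernel_abs_moment_def)
qed

end

lemma emeasure_cbox_eq_measure: "emeasure lborel (cbox a b) = ennreal (measure lborel (cbox a b))"
  using emeasure_lborel_cbox_finite[of a b] by (intro emeasure_eq_ennreal_measure) auto

lemma emeasure_unit_cube: "emeasure lborel (unit_cube :: (real ^ 'd) set) = 1"
proof -
  have "measure lborel (unit_cube :: (real ^ 'd) set) = 1" by (subst content_cbox_cart) (auto simp: interval_eq_empty_cart)
  then show ?thesis by (simp add: emeasure_cbox_eq_measure)
qed

text \<open>A point that leaves the cube under the shift by \<open>v\<close> lies, for some \<open>i\<close>, within \<open>\<bar>v $ i\<bar>\<close> of a face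
  orthogonal to the axis \<open>i\<close>.\<close>

lemma emeasure_cube_shift_out:
  fixes v :: "real ^ 'd"
  shows "emeasure lborel {x \<in> unit_cube. x + v \<notin> unit_cube} \<le> ennreal (min 1 (l1_norm v))"
proof -
  let ?B = "{x \<in> unit_cube. x + v \<notin> unit_cube}"
  have B1: "emeasure lborel ?B \<le> 1"
    using emeasure_mono[of ?B unit_cube lborel] by (auto simp: emeasure_unit_cube)
  define C where "C i = (if 0 \<le> v $ i then cbox (\<chi> j. if j = i then 1 - v $ i else 0) (1 :: real ^ 'd)
      else cbox (0 :: real ^ 'd) (\<chi> j. if j = i then - v $ i else 1))" for i
  have C_sets: "C i \<in> sets lborel" for i by (simp add: C_def)
  have C_le: "emeasure lborel (C i) \<le> ennreal \<bar>v $ i\<bar>" for i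
  proof (cases "0 \<le> v $ i")
    case True
    then have "measure lborel (C i) = (\<Prod>j\<in>UNIV. 1 - (if j = i then 1 - v $ i else 0))"
      by (simp add: C_def, subst content_cbox_cart) (auto simp: interval_eq_empty_cart not_less)
    also have "\<dots> = (\<Prod>j\<in>UNIV. if j = i then v $ i else 1)" by (intro prod.cong) auto
    finally show ?thesis using True by (simp add: C_def emeasure_cbox_eq_measure)
  next
    case False
    then have "measure lborel (C i) = (\<Prod>j\<in>UNIV. if j = i then - v $ i else 1)"
      by (simp add: C_def, subst content_cbox_cart) (auto simp: interval_eq_empty_cart not_less)
    then show ?thesis using False by (simp add: C_def emeasure_cbox_eq_measure)
  qed
  have "?B \<subseteq> (\<Union>i. C i)"
  proof
    fix x assume x: "x \<in> ?B"
    then obtain i where "x $ i + v $ i < 0 \<or> 1 < x $ i + v $ i" by (auto simp: mem_box_cart not_le)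
    then have "x \<in> C i" using x by (auto simp: C_def mem_box_cart)
        (smt (verit))+
    then show "x \<in> (\<Union>i. C i)" by auto
  qed
  then have "emeasure lborel ?B \<le> emeasure lborel (\<Union>i. C i)"
    using C_sets by (intro emeasure_mono) auto
  also have "\<dots> \<le> (\<Sum>i\<in>UNIV. emeasure lborel (C i))"
    using C_sets by (intro emeasure_subadditive_finite) auto
  also have "\<dots> \<le> (\<Sum>i\<in>UNIV. ennreal \<bar>v $ i\<bar>)" by (intro sum_mono C_le)
  also have "\<dots> = ennreal (l1_norm v)" by (simp add: l1_norm_def)
  finally show ?thesis using B1 by (simp add: min_def)
qed

lemma l1_norm_cube_diff: 
  assumes "x \<in> unit_cube" "y \<in> unit_cube" 
  shows "l1_norm (x - y :: real ^ 'd) \<le> real CARD('d)"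
proof -
  have "l1_norm (x - y) \<le> (\<Sum>i\<in>(UNIV :: 'd set). 1)"
    unfolding l1_norm_def using assms by (intro sum_mono) (auto simp: mem_box_cart abs_le_iff; smt (verit))
  then show ?thesis by simp
qed

text \<open>On the cube, which has volume 1, a density cannot exceed 1 everywhere by a fixed margin, and it
  oscillates by at most \<open>W * d powr \<beta>\<close>.\<close>

lemma holder_density_bounded:
  fixes f :: "real ^ 'd \<Rightarrow> real"
  assumes \<beta>: "0 \<le> \<beta>" and W: "0 \<le> W"
    and f[measurable]: "f \<in> borel_measurable borel" 
    and total: "(\<integral>\<^sup>+x. ennreal (f x) \<partial>lborel) = 1"
    and holder: "\<And>x x'. x \<in> unit_cube \<Longrightarrow> x' \<in> unit_cube \<Longrightarrow> \<bar>f x - f x'\<bar> \<le> W * l1_norm (x - x') powr \<beta>"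
    and x: "x \<in> unit_cube"
  shows "f x \<le> 1 + W * real CARD('d) powr \<beta>"
proof (rule ccontr)
  assume "\<not> ?thesis"
  then have c: "1 < f x - W * real CARD('d) powr \<beta>" by simp
  \<comment> \<open>The Hoelder condition forces \<open>f \<ge> ?c > 1\<close> on all of the cube, so the total mass exceeds 1.\<close>
  let ?c = "f x - W * real CARD('d) powr \<beta>"
  have "ennreal ?c = (\<integral>\<^sup>+y\<in>(unit_cube :: (real ^ 'd) set). ennreal ?c \<partial>lborel)"
    by (simp add: nn_integral_cmult_indicator emeasure_unit_cube)
  also have "\<dots> \<le> (\<integral>\<^sup>+y. ennreal (f y) \<partial>lborel)"
  proof (rule nn_integral_mono)
    fix y :: "real ^ 'd"
    show "ennreal ?c * indicator unit_cube y \<le> ennreal (f y)"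
    proof (cases "y \<in> unit_cube")
      case True
      have "f x - f y \<le> W * l1_norm (x - y) powr \<beta>" using holder[OF x True] by simp
      also have "\<dots> \<le> W * real CARD('d) powr \<beta>"
        using W \<beta> l1_norm_cube_diff[OF x True] by (intro mult_left_mono powr_mono2) (auto simp: l1_norm_nonneg)
      finally show ?thesis using True by (auto intro: ennreal_leI)
    qed simp
  qed
  finally have "ennreal ?c \<le> ennreal 1" by (simp only: total ennreal_1)
  then have "?c \<le> 1" by (subst (asm) ennreal_le_iff) auto
  then show False using c by simp
qed

text \<open>A Hoelder density of order at most 1 may jump to 0 at the boundary of the cube. The jump is seen only
  by points that the shift moves out of the cube, and their volume is at most
  \<open>min 1 (l1_norm v) \<le> l1_norm v powr \<beta>\<close>, as \<open>\<beta> \<le> 1\<close>.\<close>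

lemma translation_modulus:
  fixes f :: "real ^ 'd \<Rightarrow> real"
  assumes \<beta>: "0 < \<beta>" "\<beta> \<le> 1" and W: "0 \<le> W" and M: "0 \<le> M"
    and f[measurable]: "f \<in> borel_measurable borel" 
    and bounds: "\<And>x. 0 \<le> f x" "\<And>x. x \<in> unit_cube \<Longrightarrow> f x \<le> M" and off: "\<And>x. x \<notin> unit_cube \<Longrightarrow> f x = 0"
    and holder: "\<And>x x'. x \<in> unit_cube \<Longrightarrow> x' \<in> unit_cube \<Longrightarrow> \<bar>f x - f x'\<bar> \<le> W * l1_norm (x - x') powr \<beta>"
  shows "(\<integral>\<^sup>+x\<in>unit_cube. ennreal \<bar>f (x + v) - f x\<bar> \<partial>lborel) \<le> ennreal ((W + M) * l1_norm v powr \<beta>)"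
proof -
  let ?B = "{x \<in> unit_cube. x + v \<notin> unit_cube}"
  have B_sets[measurable]: "?B \<in> sets lborel" by measurable
  have "(\<integral>\<^sup>+x\<in>unit_cube. ennreal \<bar>f (x + v) - f x\<bar> \<partial>lborel)
      \<le> (\<integral>\<^sup>+x. ennreal (W * l1_norm v powr \<beta>) * indicator unit_cube x + ennreal M * indicator ?B x \<partial>lborel)"
  proof (rule nn_integral_mono)
    fix x :: "real ^ 'd"
    show "ennreal \<bar>f (x + v) - f x\<bar> * indicator unit_cube x 
        \<le> ennreal (W * l1_norm v powr \<beta>) * indicator unit_cube x + ennreal M * indicator ?B x"
    proof (cases "x \<in> unit_cube")
      case True
      show ?thesis
      proof (cases "x + v \<in> unit_cube")
        case True': True
        have "\<bar>f (x + v) - f x\<bar> \<le> W * l1_norm v powr \<beta>" using holder[OF True' True] by simp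
        then show ?thesis using True True' by (auto intro: ennreal_leI)
      next
        case False
        then have "\<bar>f (x + v) - f x\<bar> \<le> M" using bounds(1)[of x] bounds(2)[OF True] off[OF False] by simp
        then have "ennreal \<bar>f (x + v) - f x\<bar> \<le> ennreal M" by (rule ennreal_leI)
        then show ?thesis using True False by (simp add: add_increasing)
      qed
    qed simp
  qed
  also have "\<dots> = ennreal (W * l1_norm v powr \<beta>) + ennreal M * emeasure lborel ?B"
    by (subst nn_integral_add) (auto simp: nn_integral_cmult_indicator emeasure_unit_cube)
  also have "\<dots> \<le> ennreal (W * l1_norm v powr \<beta>) + ennreal M * ennreal (l1_norm v powr \<beta>)"
  proof (intro add_left_mono mult_left_mono)
    have "min 1 (l1_norm v) \<le> l1_norm v powr \<beta>"
    proof (cases "l1_norm v \<le> 1")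
      case True
      then show ?thesis 
        using powr_mono'[of \<beta> 1 "l1_norm v"] \<beta> by (cases "l1_norm v = 0") (auto simp: l1_norm_nonneg)
    next
      case False
      then show ?thesis using ge_one_powr_ge_zero[of "l1_norm v" \<beta>] \<beta> by simp
    qed
    with emeasure_cube_shift_out[of v] show "emeasure lborel ?B \<le> ennreal (l1_norm v powr \<beta>)"
      using ennreal_leI order_trans by blast
  qed simp
  also have "\<dots> = ennreal ((W + M) * l1_norm v powr \<beta>)"
    using W M by (simp add: ennreal_mult'[symmetric] distrib_right flip: ennreal_plus)
  finally show ?thesis .
qed

text \<open>The boundary jump prevents a pointwise bound of order \<open>h powr \<beta>\<close>, so the bias is bounded after
  integration over \<open>x\<close>, by Minkowski's inequality for integrals.\<close>

lemma kernel_bias_le_1: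
  fixes f :: "real ^ 'd \<Rightarrow> real"
  assumes \<beta>: "0 < \<beta>" "\<beta> \<le> 1" and K: "appropriate_kernel \<beta> K" and W: "0 \<le> W" and M: "0 \<le> M" and h: "0 < h"
    and f[measurable]: "f \<in> borel_measurable borel" 
    and bounds: "\<And>x. 0 \<le> f x" "\<And>x. x \<in> unit_cube \<Longrightarrow> f x \<le> M" and off: "\<And>x. x \<notin> unit_cube \<Longrightarrow> f x = 0"
    and holder: "\<And>x x'. x \<in> unit_cube \<Longrightarrow> x' \<in> unit_cube \<Longrightarrow> \<bar>f x - f x'\<bar> \<le> W * l1_norm (x - x') powr \<beta>"
  shows "(\<integral>\<^sup>+x\<in>unit_cube. ennreal \<bar>(\<integral>u. K u * f (x + h *\<^sub>R u) \<partial>lborel) - f x\<bar> \<partial>lborel) 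
    \<le> ennreal ((W + M) * h powr \<beta> * kernel_abs_moment \<beta> K)"
proof -
  note [measurable] = kernel_measurable[OF \<beta>(1) K]
  have K_int: "integrable lborel K" and K1: "(\<integral>u. K u \<partial>lborel) = 1"
    using K by (auto simp: appropriate_kernel_def)
  have f_le: "\<bar>f x\<bar> \<le> M" for x using bounds[of x] off[of x] M by (cases "x \<in> unit_cube") auto
  have pw: "ennreal \<bar>(\<integral>u. K u * f (x + h *\<^sub>R u) \<partial>lborel) - f x\<bar> 
      \<le> (\<integral>\<^sup>+u. ennreal \<bar>K u\<bar> * ennreal \<bar>f (x + h *\<^sub>R u) - f x\<bar> \<partial>lborel)" for x
  proof -
    have int: "integrable lborel (\<lambda>u. K u * f (x + h *\<^sub>R u))"
    proof (rule Bochner_Integration.integrable_bound)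
      show "integrable lborel (\<lambda>u. M * K u)" using K_int by simp
      show "AE u in lborel. norm (K u * f (x + h *\<^sub>R u)) \<le> norm (M * K u)"
        using f_le M by (auto simp: abs_mult mult.commute[of M] intro!: AE_I2 mult_left_mono)
    qed measurable
    have "(\<integral>u. K u * f (x + h *\<^sub>R u) \<partial>lborel) - f x = (\<integral>u. K u * f (x + h *\<^sub>R u) - f x * K u \<partial>lborel)"
      using int K_int K1 by simp
    also have "ennreal (norm \<dots>) \<le> (\<integral>\<^sup>+u. ennreal (norm (K u * f (x + h *\<^sub>R u) - f x * K u)) \<partial>lborel)"
      using int K_int by (intro integral_norm_bound_ennreal) auto
    also have "\<dots> = (\<integral>\<^sup>+u. ennreal \<bar>K u\<bar> * ennreal \<bar>f (x + h *\<^sub>R u) - f x\<bar> \<partial>lborel)"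
      by (intro nn_integral_cong) (simp add: ennreal_mult'[symmetric] abs_mult[symmetric] algebra_simps)
    finally show ?thesis by simp
  qed
  have "(\<integral>\<^sup>+x\<in>unit_cube. ennreal \<bar>(\<integral>u. K u * f (x + h *\<^sub>R u) \<partial>lborel) - f x\<bar> \<partial>lborel)
      \<le> (\<integral>\<^sup>+x\<in>unit_cube. (\<integral>\<^sup>+u. ennreal \<bar>K u\<bar> * ennreal \<bar>f (x + h *\<^sub>R u) - f x\<bar> \<partial>lborel) \<partial>lborel)"
    by (intro nn_integral_mono mult_right_mono pw) simp
  also have "\<dots> = (\<integral>\<^sup>+x. (\<integral>\<^sup>+u. ennreal \<bar>K u\<bar> * (ennreal \<bar>f (x + h *\<^sub>R u) - f x\<bar> * indicator unit_cube x) \<partial>lborel) \<partial>lborel)"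
    by (intro nn_integral_cong) (simp add: nn_integral_multc[symmetric] mult.assoc)
  also have "\<dots> = (\<integral>\<^sup>+u. (\<integral>\<^sup>+x. ennreal \<bar>K u\<bar> * (ennreal \<bar>f (x + h *\<^sub>R u) - f x\<bar> * indicator unit_cube x) \<partial>lborel) \<partial>lborel)"
    by (rule lborel_pair.Fubini') measurable
  also have "\<dots> = (\<integral>\<^sup>+u. ennreal \<bar>K u\<bar> * (\<integral>\<^sup>+x\<in>unit_cube. ennreal \<bar>f (x + h *\<^sub>R u) - f x\<bar> \<partial>lborel) \<partial>lborel)"
    by (intro nn_integral_cong nn_integral_cmult) measurable
  also have "\<dots> \<le> (\<integral>\<^sup>+u. ennreal \<bar>K u\<bar> * ennreal ((W + M) * l1_norm (h *\<^sub>R u) powr \<beta>) \<partial>lborel)"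
    by (intro nn_integral_mono mult_left_mono translation_modulus[OF \<beta> W M f bounds off holder]) auto
  also have "\<dots> = (\<integral>\<^sup>+u. ennreal ((W + M) * h powr \<beta> * (\<bar>K u\<bar> * l1_norm u powr \<beta>)) \<partial>lborel)"
    using h W M 
    by (intro nn_integral_cong) (simp add: ennreal_mult'[symmetric] l1_norm_scaleR powr_mult l1_norm_nonneg mult_ac)
  also have "\<dots> = ennreal ((W + M) * h powr \<beta> * kernel_abs_moment \<beta> K)"
    unfolding kernel_abs_moment_def
    by (subst nn_integral_eq_integral) (use integrable_kernel_moment[OF \<beta>(1) K] W M in auto)
  finally show ?thesis .
qed

text \<open>The \<open>L\<^sup>1\<close> bias of kernel smoothing, with a constant that is uniform over the densities considered.
  For \<open>\<beta> \<le> 1\<close> it comes from the translation modulus, for \<open>\<beta> > 1\<close> from the pointwise Taylor bound.\<close>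

lemma kernel_bias:
  fixes f :: "real ^ 'd \<Rightarrow> real"
  assumes \<beta>: "0 < \<beta>" and K: "appropriate_kernel \<beta> K" and W: "0 \<le> W" and h: "0 < h"
    and f[measurable]: "f \<in> borel_measurable borel" and nonneg: "\<And>x. 0 \<le> f x"
    and off: "\<And>x. x \<notin> unit_cube \<Longrightarrow> f x = 0"
    and total: "(\<integral>\<^sup>+x. ennreal (f x) \<partial>lborel) = 1"
    and diff: "times_differentiable (strict_floor \<beta>) f"
    and holder: "\<And>is x x'. length is = strict_floor \<beta> \<Longrightarrow> x \<in> unit_cube \<Longrightarrow> x' \<in> unit_cube \<Longrightarrow> 
      \<bar>iterated_partial is f x - iterated_partial is f x'\<bar> \<le> W * l1_norm (x - x') powr (\<beta> - real (strict_floor \<beta>))"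
  shows "(\<integral>\<^sup>+x\<in>unit_cube. ennreal \<bar>(\<integral>u. K u * f (x + h *\<^sub>R u) \<partial>lborel) - f x\<bar> \<partial>lborel) 
    \<le> ennreal ((1 + W + W * real CARD('d) powr \<beta>) * h powr \<beta> * kernel_abs_moment \<beta> K)"
proof (cases "strict_floor \<beta> = 0")
  case True
  then have \<beta>1: "\<beta> \<le> 1" using strict_floor_bounds(2)[OF \<beta>] by simp
  have h0: "\<bar>f x - f x'\<bar> \<le> W * l1_norm (x - x') powr \<beta>" if "x \<in> unit_cube" "x' \<in> unit_cube" for x x'
    using holder[of "[]"] that True by simp
  have M: "f x \<le> 1 + W * real CARD('d) powr \<beta>" if "x \<in> unit_cube" for x
    using holder_density_bounded[OF _ W f total h0 that] \<beta> by simp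
  show ?thesis
    using kernel_bias_le_1[OF \<beta> \<beta>1 K W _ h f nonneg M off h0] W by (simp add: add_ac)
next
  case False
  have "ennreal \<bar>(\<integral>u. K u * f (x + h *\<^sub>R u) \<partial>lborel) - f x\<bar> 
      \<le> ennreal (W * h powr \<beta> * kernel_abs_moment \<beta> K)" if x: "x \<in> unit_cube" for x
  proof (intro ennreal_leI kernel_bias_pointwise[OF \<beta> K h W f])
    fix v
    show "\<bar>f (x + v) - (\<Sum>k\<le>strict_floor \<beta>. (\<Sum>is | length is = k. coord_monomial is v * iterated_partial is f x) / fact k)\<bar>
        \<le> W * l1_norm v powr \<beta>"
      by (rule taylor_remainder_bound[OF diff _ off W _ holder x]) 
        (use False strict_floor_bounds(1)[OF \<beta>] in auto)
  qed
  then have "(\<integral>\<^sup>+x\<in>unit_cube. ennreal \<bar>(\<integral>u. K u * f (x + h *\<^sub>R u) \<partial>lborel) - f x\<bar> \<partial>lborel)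
      \<le> (\<integral>\<^sup>+x\<in>(unit_cube :: (real ^ 'd) set). ennreal (W * h powr \<beta> * kernel_abs_moment \<beta> K) \<partial>lborel)"
    by (intro nn_integral_mono) (auto simp: indicator_def)
  also have "\<dots> = ennreal (W * h powr \<beta> * kernel_abs_moment \<beta> K)"
    by (simp add: nn_integral_cmult_indicator emeasure_unit_cube)
  also have "\<dots> \<le> ennreal ((1 + W + W * real CARD('d) powr \<beta>) * h powr \<beta> * kernel_abs_moment \<beta> K)"
    using W by (intro ennreal_leI mult_right_mono kernel_abs_moment_nonneg[OF \<beta> K]) auto
  finally show ?thesis .
qed

section \<open>The partition into bins and the joint law\<close>

text \<open>Recovers the index of an interval from any of its points; hence the intervals are disjoint.\<close>

lemma bin_interval_index:
  assumes "1 \<le> j" "j \<le> m" "t \<in> bin_interval m j"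
  shows "j = (if t = 1 then m else nat \<lfloor>real m * t\<rfloor> + 1)"
proof (cases "t = 1")
  case True
  have "\<not> j < m" 
  proof
    assume "j < m"
    then have "1 < real j / real m" using assms True by (simp add: bin_interval_def)
    then show False using \<open>j < m\<close> by (simp add: field_simps)
  qed
  then show ?thesis using True assms by simp
next
  case False
  have "(real j - 1) / real m \<le> t" "t < real j / real m"
    using assms False by (auto simp: bin_interval_def split: if_splits)
  then have "real j - 1 \<le> real m * t" "real m * t < real j"
    using assms by (simp_all add: field_simps)
  then have "\<lfloor>real m * t\<rfloor> = int j - 1" by (intro floor_unique) auto
  then show ?thesis using False assms by simp
qed

lemma bin_interval_subset: "1 \<le> j \<Longrightarrow> j \<le> m \<Longrightarrow> bin_interval m j \<subseteq> {(real j - 1) / real m..real j / real m}"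
  by (auto simp: bin_interval_def)

lemma bin_interval_subset_unit: 
  assumes "1 \<le> j" "j \<le> m" shows "bin_interval m j \<subseteq> {0..1}"
proof -
  have "0 \<le> (real j - 1) / real m" "real j / real m \<le> 1" using assms by (auto simp: field_simps)
  with bin_interval_subset[OF assms] show ?thesis by force
qed

lemma bin_interval_cover:
  assumes "0 < m" "0 \<le> t" "t \<le> 1"
  shows "\<exists>j\<in>{1..m}. t \<in> bin_interval m j"
proof (cases "t = 1")
  case True
  then show ?thesis using assms by (intro bexI[of _ m]) (auto simp: bin_interval_def)
next
  case False
  define j where "j = nat \<lfloor>real m * t\<rfloor> + 1"
  have r: "real j = of_int \<lfloor>real m * t\<rfloor> + 1" using assms by (simp add: j_def)
  then have b: "real j - 1 \<le> real m * t" "real m * t < real j" by linarith+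
  have "real m * t < real m" using assms False by simp
  with b have "j \<le> m" by linarith
  moreover have "1 \<le> j" by (simp add: j_def)
  ultimately show ?thesis using b assms
    by (intro bexI[of _ j]) (auto simp: bin_interval_def field_simps)
qed

abbreviation bin_indices :: "nat \<Rightarrow> ('d \<Rightarrow> nat) set" where
  "bin_indices m \<equiv> {j. \<forall>k. j k \<in> {1..m}}"

lemma bin_indices_eq: "bin_indices m = (UNIV :: 'd set) \<rightarrow>\<^sub>E {1..m}"
  by (auto simp: PiE_def)

lemma finite_bin_indices: "finite (bin_indices m :: ('d::finite \<Rightarrow> nat) set)"
  unfolding bin_indices_eq by (intro finite_PiE) auto

lemma card_bin_indices: "card (bin_indices m :: ('d::finite \<Rightarrow> nat) set) = m ^ CARD('d)"
  unfolding bin_indices_eq by (simp add: card_PiE)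

lemma bin_unique:
  assumes "j \<in> bin_indices m" "j' \<in> bin_indices m" "z \<in> bin m j" "z \<in> bin m j'"
  shows "j = j'"
proof
  fix k
  show "j k = j' k"
    using bin_interval_index[of "j k" m "z $ k"] bin_interval_index[of "j' k" m "z $ k"] assms 
    by (auto simp: bin_def)
qed

lemma bin_cover:
  assumes "0 < m" "z \<in> unit_cube" 
  obtains j where "j \<in> bin_indices m" "z \<in> bin m j"
proof -
  have "\<forall>k. \<exists>i\<in>{1..m}. z $ k \<in> bin_interval m i"
    using assms by (intro allI bin_interval_cover) (auto simp: mem_box_cart)
  then obtain j where "\<forall>k. j k \<in> {1..m} \<and> z $ k \<in> bin_interval m (j k)" by metis
  then show ?thesis by (intro that[of j]) (auto simp: bin_def)
qed

lemma bin_subset_unit_cube: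
  assumes "j \<in> bin_indices m" shows "bin m j \<subseteq> unit_cube"
proof
  fix z assume "z \<in> bin m j"
  then have "z $ k \<in> {0..1}" for k
    using assms bin_interval_subset_unit[of "j k" m] by (auto simp: bin_def)
  then show "z \<in> unit_cube" by (simp add: mem_box_cart)
qed

lemma bin_diameter:
  fixes z z' :: "real ^ 'd"
  assumes j: "j \<in> bin_indices m" and z: "z \<in> bin m j" "z' \<in> bin m j"
  shows "l1_norm (z - z') \<le> real CARD('d) / real m"
proof -
  have "\<bar>(z - z') $ k\<bar> \<le> 1 / real m" for k
  proof -
    have "z $ k \<in> {(real (j k) - 1) / real m..real (j k) / real m}" 
      "z' $ k \<in> {(real (j k) - 1) / real m..real (j k) / real m}"
      using j z bin_interval_subset[of "j k" m] by (auto simp: bin_def)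
    then show ?thesis by (auto simp: abs_le_iff diff_divide_distrib)
  qed
  then have "l1_norm (z - z') \<le> (\<Sum>k\<in>(UNIV :: 'd set). 1 / real m)"
    unfolding l1_norm_def by (intro sum_mono) auto
  then show ?thesis by simp
qed

lemma bin_interval_borel [measurable]: "bin_interval m j \<in> sets borel"
  by (simp add: bin_interval_def)

lemma bin_borel [measurable]: "bin m j \<in> sets borel"
  unfolding bin_def by measurable

lemma estimator_on_bin:
  fixes K :: "real ^ 'dx \<Rightarrow> real" and z :: "real ^ 'dz"
  assumes "j \<in> bin_indices m" "z \<in> bin m j"
  shows "cond_density_estimator K h m n s x z = 
    (\<Sum>i=1..n. indicator (bin m j) (snd (s i)) * (K ((fst (s i) - x) /\<^sub>R h) / h ^ CARD('dx))) 
      / (\<Sum>i=1..n. indicator (bin m j) (snd (s i)))"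
proof -
  have "cond_density_estimator K h m n s x z = (\<Sum>j'\<in>bin_indices m. if j' = j then 
      (\<Sum>i = 1..n. indicator (bin m j) (snd (s i)) * K ((fst (s i) - x) /\<^sub>R h)) /
         (h ^ CARD('dx) * (\<Sum>i = 1..n. indicator (bin m j) (snd (s i)))) else 0)"
    unfolding cond_density_estimator_def
  proof (intro sum.cong refl)
    fix j' :: "'dz \<Rightarrow> nat" assume "j' \<in> bin_indices m"
    then have off: "z \<notin> bin m j'" if "j' \<noteq> j" using assms bin_unique that by blast
    show "indicator (bin m j') z * ((\<Sum>i = 1..n. indicator (bin m j') (snd (s i)) * K ((fst (s i) - x) /\<^sub>R h)) /
         (h ^ CARD('dx) * (\<Sum>i = 1..n. indicator (bin m j') (snd (s i))))) = (if j' = j then 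
      (\<Sum>i = 1..n. indicator (bin m j) (snd (s i)) * K ((fst (s i) - x) /\<^sub>R h)) /
         (h ^ CARD('dx) * (\<Sum>i = 1..n. indicator (bin m j) (snd (s i)))) else 0)"
      using assms(2) off by (cases "j' = j") simp_all
  qed
  also have "\<dots> = (\<Sum>i = 1..n. indicator (bin m j) (snd (s i)) * K ((fst (s i) - x) /\<^sub>R h)) /
         (h ^ CARD('dx) * (\<Sum>i = 1..n. indicator (bin m j) (snd (s i))))"
    by (subst sum.delta[OF finite_bin_indices]) (use assms(1) in simp)
  finally show ?thesis
    by (simp only: times_divide_eq_right sum_divide_distrib[symmetric] divide_divide_eq_left)
qed

lemma nn_integral_lborel_affine:
  fixes F :: "'a::euclidean_space \<Rightarrow> ennreal" 
  assumes [measurable]: "F \<in> borel_measurable borel" and "c \<noteq> 0"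
  shows "(\<integral>\<^sup>+y. F y \<partial>lborel) = ennreal (\<bar>c\<bar> ^ DIM('a)) * (\<integral>\<^sup>+u. F (t + c *\<^sub>R u) \<partial>lborel)"
  by (subst lborel_affine[OF assms(2), of t])
    (simp add: nn_integral_density nn_integral_distr nn_integral_cmult)

lemma integral_lborel_affine:
  fixes F :: "'a::euclidean_space \<Rightarrow> real" 
  assumes [measurable]: "F \<in> borel_measurable borel" and "c \<noteq> 0"
  shows "(\<integral>y. F y \<partial>lborel) = \<bar>c\<bar> ^ DIM('a) * (\<integral>u. F (t + c *\<^sub>R u) \<partial>lborel)"
proof -
  have "(\<integral>y. F y \<partial>lborel) = (\<integral>y. F y \<partial>density (distr lborel borel (\<lambda>x. t + c *\<^sub>R x)) (\<lambda>_. \<bar>c\<bar>^DIM('a)))"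
    by (subst lborel_affine[OF assms(2), of t]) (rule refl)
  also have "\<dots> = \<bar>c\<bar> ^ DIM('a) * (\<integral>u. F (t + c *\<^sub>R u) \<partial>lborel)"
    by (subst integral_density) (simp_all add: integral_distr)
  finally show ?thesis .
qed

locale cond_density =
  fixes p :: "real ^ 'dx \<Rightarrow> real ^ 'dz \<Rightarrow> real" and q :: "real ^ 'dz \<Rightarrow> real"
  assumes p_meas: "case_prod p \<in> borel_measurable borel"
    and q_meas [measurable]: "q \<in> borel_measurable borel"
    and p_nonneg: "0 \<le> p x z" and q_nonneg: "0 \<le> q z"
    and q_off: "z \<notin> unit_cube \<Longrightarrow> q z = 0"
    and p_total: "z \<in> unit_cube \<Longrightarrow> (\<integral>\<^sup>+x. ennreal (p x z) \<partial>lborel) = 1"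
    and q_total: "(\<integral>\<^sup>+z. ennreal (q z) \<partial>lborel) = 1"
begin

lemma p_meas_prod [measurable]: "case_prod p \<in> borel_measurable (borel \<Otimes>\<^sub>M borel)"
  using p_meas by (simp add: borel_prod)

lemma sets_joint_law [measurable_cong]: "sets (joint_law p q) = sets (borel \<Otimes>\<^sub>M borel)"
  unfolding joint_law_def borel_prod by simp

lemma nn_integral_joint_law:
  assumes [measurable]: "F \<in> borel_measurable (borel \<Otimes>\<^sub>M borel)"
  shows "(\<integral>\<^sup>+b. F b \<partial>joint_law p q) 
    = (\<integral>\<^sup>+z. (\<integral>\<^sup>+x. ennreal (p x z) * F (x, z) \<partial>lborel) * ennreal (q z) \<partial>lborel)"
proof -
  have "(\<integral>\<^sup>+b. F b \<partial>joint_law p q) 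
      = (\<integral>\<^sup>+b. (case b of (x, z) \<Rightarrow> ennreal (p x z * q z)) * F b \<partial>(lborel \<Otimes>\<^sub>M lborel))"
    unfolding joint_law_def lborel_prod[symmetric] by (subst nn_integral_density) auto
  also have "\<dots> = (\<integral>\<^sup>+z. (\<integral>\<^sup>+x. ennreal (p x z * q z) * F (x, z) \<partial>lborel) \<partial>lborel)"
    by (subst lborel_pair.nn_integral_snd[symmetric]) auto
  also have "\<dots> = (\<integral>\<^sup>+z. (\<integral>\<^sup>+x. ennreal (p x z) * F (x, z) * ennreal (q z) \<partial>lborel) \<partial>lborel)"
    by (simp add: ennreal_mult' p_nonneg q_nonneg mult_ac)
  also have "\<dots> = (\<integral>\<^sup>+z. (\<integral>\<^sup>+x. ennreal (p x z) * F (x, z) \<partial>lborel) * ennreal (q z) \<partial>lborel)"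
    by (intro nn_integral_cong nn_integral_multc) measurable
  finally show ?thesis .
qed

lemma nn_integral_joint_law_snd:
  assumes [measurable]: "F \<in> borel_measurable borel"
  shows "(\<integral>\<^sup>+b. F (snd b) \<partial>joint_law p q) = (\<integral>\<^sup>+z. F z * ennreal (q z) \<partial>lborel)"
proof -
  have "(\<integral>\<^sup>+b. F (snd b) \<partial>joint_law p q) 
      = (\<integral>\<^sup>+z. (\<integral>\<^sup>+x. ennreal (p x z) * F z \<partial>lborel) * ennreal (q z) \<partial>lborel)"
    by (subst nn_integral_joint_law) auto
  also have "\<dots> = (\<integral>\<^sup>+z. F z * ennreal (q z) \<partial>lborel)"
  proof (intro nn_integral_cong)
    fix z :: "real ^ 'dz"
    have "(\<integral>\<^sup>+x. ennreal (p x z) * F z \<partial>lborel) = (\<integral>\<^sup>+x. ennreal (p x z) \<partial>lborel) * F z"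
      by (rule nn_integral_multc) measurable
    then show "(\<integral>\<^sup>+x. ennreal (p x z) * F z \<partial>lborel) * ennreal (q z) = F z * ennreal (q z)"
      using p_total[of z] q_off[of z] by (cases "z \<in> unit_cube") auto
  qed
  finally show ?thesis .
qed

lemma integral_joint_law:
  fixes G :: "(real ^ 'dx) \<times> (real ^ 'dz) \<Rightarrow> real"
  assumes G: "integrable (joint_law p q) G"
  shows "integrable lborel (\<lambda>z. (\<integral>x. p x z * G (x, z) \<partial>lborel) * q z)"
    and "(\<integral>b. G b \<partial>joint_law p q) = (\<integral>z. (\<integral>x. p x z * G (x, z) \<partial>lborel) * q z \<partial>lborel)"
proof -
  have [measurable]: "G \<in> borel_measurable (borel \<Otimes>\<^sub>M borel)"
    using borel_measurable_integrable[OF G] 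
    by (simp only: measurable_cong_sets[OF sets_joint_law refl])
  have dens: "joint_law p q = density (lborel \<Otimes>\<^sub>M lborel) (\<lambda>b. ennreal (case b of (x, z) \<Rightarrow> p x z * q z))"
    by (simp add: joint_law_def lborel_prod case_prod_unfold)
  have "integrable (lborel \<Otimes>\<^sub>M lborel) (\<lambda>b. (case b of (x, z) \<Rightarrow> p x z * q z) * G b)"
    using G unfolding dens
    by (subst (asm) integrable_density) (auto simp: p_nonneg q_nonneg case_prod_unfold)
  then have int: "integrable (lborel \<Otimes>\<^sub>M lborel) (case_prod (\<lambda>x z. p x z * G (x, z) * q z))"
    by (simp add: case_prod_unfold mult_ac)
  have inner: "(\<lambda>z. \<integral>x. p x z * G (x, z) * q z \<partial>lborel) = (\<lambda>z. (\<integral>x. p x z * G (x, z) \<partial>lborel) * q z)"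
    by (intro ext integral_mult_left_zero)
  show "integrable lborel (\<lambda>z. (\<integral>x. p x z * G (x, z) \<partial>lborel) * q z)"
    using lborel_pair.integrable_snd[OF int] by (simp only: inner)
  have "(\<integral>b. G b \<partial>joint_law p q) = (\<integral>b. (case b of (x, z) \<Rightarrow> p x z * q z) * G b \<partial>(lborel \<Otimes>\<^sub>M lborel))"
    unfolding dens
    by (subst integral_density) (auto simp: p_nonneg q_nonneg case_prod_unfold)
  also have "\<dots> = (\<integral>b. (case b of (x, z) \<Rightarrow> p x z * G (x, z) * q z) \<partial>(lborel \<Otimes>\<^sub>M lborel))"
    by (simp add: case_prod_unfold mult_ac)
  also have "\<dots> = (\<integral>z. (\<integral>x. p x z * G (x, z) * q z \<partial>lborel) \<partial>lborel)"
    by (rule lborel_pair.integral_snd[OF int, symmetric])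
  finally show "(\<integral>b. G b \<partial>joint_law p q) = (\<integral>z. (\<integral>x. p x z * G (x, z) \<partial>lborel) * q z \<partial>lborel)"
    by (simp only: inner)
qed

sublocale joint: prob_space "joint_law p q"
proof
  show "emeasure (joint_law p q) (space (joint_law p q)) = 1"
    using nn_integral_joint_law_snd[of "\<lambda>_. 1"] q_total by simp
qed

definition cell_mass :: "(real ^ 'dz) set \<Rightarrow> real" where
  "cell_mass A = joint.prob (UNIV \<times> A)"

lemma cell_sets [measurable]: "A \<in> sets borel \<Longrightarrow> UNIV \<times> A \<in> sets (joint_law p q)"
  by (simp add: sets_joint_law)

lemma cell_mass_eq:
  assumes [measurable]: "A \<in> sets borel"
  shows "ennreal (cell_mass A) = (\<integral>\<^sup>+z. indicator A z * ennreal (q z) \<partial>lborel)"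
proof -
  have "ennreal (cell_mass A) = emeasure (joint_law p q) (UNIV \<times> A)"
    by (simp add: cell_mass_def joint.emeasure_eq_measure)
  also have "\<dots> = (\<integral>\<^sup>+b. indicator (UNIV \<times> A) b \<partial>joint_law p q)"
    by (rule nn_integral_indicator[symmetric]) measurable
  also have "\<dots> = (\<integral>\<^sup>+b. indicator A (snd b) \<partial>joint_law p q)"
    by (intro nn_integral_cong) (auto simp: indicator_def)
  finally show ?thesis by (simp add: nn_integral_joint_law_snd)
qed

text \<open>The mean of the rescaled kernel \<open>K ((X - x) /\<^sub>R h) / h ^ d\<^sub>X\<close> given \<open>Z = z\<close>, after the substitution
  \<open>y = x + h u\<close>.\<close>

definition smoothed :: "(real ^ 'dx \<Rightarrow> real) \<Rightarrow> real \<Rightarrow> real ^ 'dx \<Rightarrow> real ^ 'dz \<Rightarrow> real" where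
  "smoothed K h x z = (\<integral>u. K u * p (x + h *\<^sub>R u) z \<partial>lborel)"

lemma smoothed_meas:
  assumes [measurable]: "K \<in> borel_measurable borel"
  shows "case_prod (smoothed K h) \<in> borel_measurable (borel \<Otimes>\<^sub>M borel)"
  unfolding smoothed_def by measurable

lemma integral_scaled_kernel:
  assumes [measurable]: "K \<in> borel_measurable borel" and h: "0 < h"
  shows "(\<integral>y. p y z * (K ((y - x) /\<^sub>R h) / h ^ CARD('dx)) \<partial>lborel) = smoothed K h x z"
proof -
  have "(\<integral>y. p y z * (K ((y - x) /\<^sub>R h) / h ^ CARD('dx)) \<partial>lborel) 
      = h ^ CARD('dx) * (\<integral>u. p (x + h *\<^sub>R u) z * (K u / h ^ CARD('dx)) \<partial>lborel)"
    using h by (subst integral_lborel_affine[of _ h x]) (auto simp: DIM_cart)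
  also have "(\<integral>u. p (x + h *\<^sub>R u) z * (K u / h ^ CARD('dx)) \<partial>lborel) = smoothed K h x z / h ^ CARD('dx)"
    unfolding smoothed_def integral_divide_zero[symmetric] by (simp add: mult_ac)
  finally show ?thesis using h by simp
qed

end

section \<open>Risk within a bin and over all bins\<close>

context cond_density
begin

lemma cell_mass_nonneg: "0 \<le> cell_mass A" by (simp add: cell_mass_def)

text \<open>The estimate for local averages, applied to the cell of all \<open>(x, z)\<close> with \<open>z \<in> A\<close>. All terms take
  values in the extended nonnegative reals, so that the estimate holds for every \<open>x\<close>: if the second
  moment of the rescaled kernel on the cell is infinite, as may happen on a null set of \<open>x\<close>, the bound
  is trivial; otherwise the rescaled kernel is integrable on the cell and Fubini's theorem expresses its
  mean through \<open>smoothed\<close>.\<close>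

lemma expected_error_in_bin:
  fixes K :: "real ^ 'dx \<Rightarrow> real" and h \<tau> :: real and m n :: nat and j :: "'dz \<Rightarrow> nat"
  assumes K[measurable]: "K \<in> borel_measurable borel" and h: "0 < h" and \<tau>: "0 < \<tau>" and n: "1 \<le> n"
    and j: "j \<in> bin_indices m" and pos: "0 < cell_mass (bin m j)" and z: "z \<in> bin m j"
  defines "A \<equiv> bin m j" and "\<mu> \<equiv> cell_mass (bin m j)"
  defines "k \<equiv> \<lambda>x b. K ((fst b - x) /\<^sub>R h) / h ^ CARD('dx)"
  shows "(\<integral>\<^sup>+s. ennreal \<bar>cond_density_estimator K h m n s x z - p x z\<bar> \<partial>(\<Pi>\<^sub>M i\<in>{1..n}. joint_law p q))
    \<le> ennreal (\<tau> / (2 * \<mu>)) * (\<integral>\<^sup>+b. ennreal (indicator (UNIV \<times> A) b * (k x b)\<^sup>2) \<partial>joint_law p q)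
      + ennreal ((1 / \<tau> + p x z) / (real n * \<mu>))
      + ennreal (1 / \<mu>) * (\<integral>\<^sup>+z'. indicator A z' * ennreal (q z' * \<bar>smoothed K h x z' - p x z\<bar>) \<partial>lborel)"
proof (cases "(\<integral>\<^sup>+b. ennreal (indicator (UNIV \<times> A) b * (k x b)\<^sup>2) \<partial>joint_law p q) = \<infinity>")
  case True
  have "0 < \<tau> / (2 * \<mu>)" using \<tau> pos by (simp add: \<mu>_def)
  then have "ennreal (\<tau> / (2 * \<mu>)) * \<infinity> = \<infinity>" by (simp add: ennreal_mult_top ennreal_eq_0_iff)
  then show ?thesis unfolding True by simp
next
  case False
  have A[measurable]: "A \<in> sets borel" by (simp add: A_def)
  let ?S = "(UNIV :: (real ^ 'dx) set) \<times> A"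
  interpret hit_count "joint_law p q" "{1..n}" ?S
    using n pos by unfold_locales (auto simp: A_def cell_mass_def)
  have k_meas[measurable]: "k x \<in> borel_measurable (joint_law p q)" unfolding k_def by measurable
  have \<mu>: "\<mu> = joint.prob ?S" by (simp add: \<mu>_def A_def cell_mass_def)
  have sq: "integrable (joint_law p q) (\<lambda>b. indicator ?S b * (k x b)\<^sup>2)"
    using False by (intro integrableI_bounded) (auto simp: less_top)
  have int1: "integrable (joint_law p q) (\<lambda>b. indicator ?S b * k x b)"
  proof (rule joint.square_integrable_imp_integrable)
    have "(\<lambda>b. (indicator ?S b * k x b)\<^sup>2) = (\<lambda>b. indicator ?S b * (k x b)\<^sup>2)"
      by (auto simp: indicator_def)
    then show "integrable (joint_law p q) (\<lambda>b. (indicator ?S b * k x b)\<^sup>2)" using sq by simp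
  qed measurable
  define c where "c = (\<integral>b. indicator ?S b * k x b \<partial>joint_law p q) / joint.prob ?S"
  have est: "cond_density_estimator K h m n s x z = (\<Sum>i\<in>{1..n}. indicator ?S (s i) * k x (s i)) / hits s" for s
  proof -
    have "indicator ?S (s i) = (indicator A (snd (s i)) :: real)" for i
      by (auto simp: indicator_def mem_Times_iff)
    then show ?thesis unfolding estimator_on_bin[OF j z] hits_def k_def A_def[symmetric] by simp
  qed
  have V: "ennreal (\<integral>b. indicator ?S b * (k x b)\<^sup>2 \<partial>joint_law p q) 
      = (\<integral>\<^sup>+b. ennreal (indicator ?S b * (k x b)\<^sup>2) \<partial>joint_law p q)"
    by (rule nn_integral_eq_integral[symmetric]) (use sq in auto)
  have fib: "(\<integral>y. p y z' * (indicator ?S (y, z') * k x (y, z')) \<partial>lborel) * q z' 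
      = indicator A z' * q z' * smoothed K h x z'" for z'
  proof (cases "z' \<in> A")
    case True
    then show ?thesis using integral_scaled_kernel[OF K h, of z' x] by (simp add: k_def)
  qed simp
  have int2: "integrable lborel (\<lambda>z'. indicator A z' * q z' * smoothed K h x z')"
    and eq2: "(\<integral>b. indicator ?S b * k x b \<partial>joint_law p q) = (\<integral>z'. indicator A z' * q z' * smoothed K h x z' \<partial>lborel)"
    using integral_joint_law[OF int1] by (simp_all only: fib)
  have mass: "(\<integral>\<^sup>+z'. ennreal (indicator A z' * q z') \<partial>lborel) = ennreal \<mu>"
    using cell_mass_eq[OF A] by (simp add: \<mu>_def A_def[symmetric] ennreal_mult' q_nonneg ennreal_indicator)
  have int3: "integrable lborel (\<lambda>z'. indicator A z' * q z')"
    using mass by (intro integrableI_nonneg) (auto simp: q_nonneg)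
  have eq3: "(\<integral>z'. indicator A z' * q z' \<partial>lborel) = \<mu>"
    using mass pos by (subst integral_eq_nn_integral) (auto simp: q_nonneg \<mu>_def)
  have "c - p x z = (1 / \<mu>) * (\<integral>z'. indicator A z' * q z' * smoothed K h x z' - p x z * (indicator A z' * q z') \<partial>lborel)"
  proof -
    have "(\<integral>z'. indicator A z' * q z' * smoothed K h x z' - p x z * (indicator A z' * q z') \<partial>lborel)
        = (\<integral>b. indicator ?S b * k x b \<partial>joint_law p q) - p x z * \<mu>"
      by (subst Bochner_Integration.integral_diff) (use int2 int3 in \<open>simp_all only: integrable_mult_right integral_mult_right_zero eq2 eq3\<close>)
    then show ?thesis
      using pos unfolding c_def \<mu>[symmetric] by (simp add: \<mu>_def diff_divide_distrib)
  qed
  then have "ennreal \<bar>c - p x z\<bar> = ennreal (1 / \<mu>) * ennreal (norm (\<integral>z'. indicator A z' * q z' * smoothed K h x z' - p x z * (indicator A z' * q z') \<partial>lborel))"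
    using pos by (simp add: abs_mult \<mu>_def ennreal_mult' del: times_divide_eq_left mult_1)
  also have "\<dots> \<le> ennreal (1 / \<mu>) * (\<integral>\<^sup>+z'. ennreal (norm (indicator A z' * q z' * smoothed K h x z' - p x z * (indicator A z' * q z'))) \<partial>lborel)"
    using int2 int3 by (intro mult_left_mono integral_norm_bound_ennreal) auto
  also have "\<dots> = ennreal (1 / \<mu>) * (\<integral>\<^sup>+z'. indicator A z' * ennreal (q z' * \<bar>smoothed K h x z' - p x z\<bar>) \<partial>lborel)"
  proof (intro arg_cong2[where f="(*)"] refl nn_integral_cong)
    fix z' :: "real ^ 'dz"
    have "norm (indicator A z' * q z' * smoothed K h x z' - p x z * (indicator A z' * q z')) 
        = indicator A z' * (q z' * \<bar>smoothed K h x z' - p x z\<bar>)"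
      using q_nonneg[of z'] by (cases "z' \<in> A") (simp_all add: mult.commute[of "p x z"] abs_mult flip: right_diff_distrib)
    then show "ennreal (norm (indicator A z' * q z' * smoothed K h x z' - p x z * (indicator A z' * q z'))) 
        = indicator A z' * ennreal (q z' * \<bar>smoothed K h x z' - p x z\<bar>)"
      by (simp add: ennreal_mult' ennreal_indicator)
  qed
  finally have bias: "ennreal \<bar>c - p x z\<bar> 
      \<le> ennreal (1 / \<mu>) * (\<integral>\<^sup>+z'. indicator A z' * ennreal (q z' * \<bar>smoothed K h x z' - p x z\<bar>) \<partial>lborel)" .
  have "(\<integral>\<^sup>+s. ennreal \<bar>cond_density_estimator K h m n s x z - p x z\<bar> \<partial>Q)
      \<le> ennreal (\<tau> / (2 * \<mu>) * (\<integral>b. indicator ?S b * (k x b)\<^sup>2 \<partial>joint_law p q) 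
        + (1 / \<tau> + \<bar>p x z\<bar>) / (card {1..n} * \<mu>) + \<bar>c - p x z\<bar>)"
    unfolding est \<mu> c_def by (rule expected_local_average_error[OF k_meas \<tau> sq])
  also have "\<dots> = ennreal (\<tau> / (2 * \<mu>)) * ennreal (\<integral>b. indicator ?S b * (k x b)\<^sup>2 \<partial>joint_law p q)
        + ennreal ((1 / \<tau> + p x z) / (real n * \<mu>)) + ennreal \<bar>c - p x z\<bar>"
    using \<tau> pos p_nonneg[of x z] by (simp add: ennreal_mult'[symmetric] \<mu>_def flip: ennreal_plus)
  finally show ?thesis unfolding V using bias by (meson add_left_mono order_trans)
qed

text \<open>Integrating over \<open>x\<close> first turns the rescaled kernel into the constant \<open>\<integral>K\<^sup>2 / h ^ d\<^sub>X\<close>,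
  whatever the density.\<close>

lemma integrated_kernel_second_moment:
  fixes K :: "real ^ 'dx \<Rightarrow> real" and h :: real
  assumes K[measurable]: "K \<in> borel_measurable borel" and K2: "integrable lborel (\<lambda>u. (K u)\<^sup>2)" and h: "0 < h"
    and A[measurable]: "A \<in> sets borel"
  shows "(\<integral>\<^sup>+x. (\<integral>\<^sup>+b. ennreal (indicator (UNIV \<times> A) b * (K ((fst b - x) /\<^sub>R h) / h ^ CARD('dx))\<^sup>2) \<partial>joint_law p q) \<partial>lborel)
    = ennreal ((\<integral>u. (K u)\<^sup>2 \<partial>lborel) / h ^ CARD('dx) * cell_mass A)"
proof -
  interpret pair_sigma_finite "joint_law p q" lborel ..
  let ?d = "CARD('dx)" and ?\<kappa> = "\<integral>u. (K u)\<^sup>2 \<partial>lborel"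
  have inner: "(\<integral>\<^sup>+x. ennreal ((K ((y - x) /\<^sub>R h) / h ^ ?d)\<^sup>2) \<partial>lborel) = ennreal (?\<kappa> / h ^ ?d)" for y
  proof -
    have "(\<integral>\<^sup>+x. ennreal ((K ((y - x) /\<^sub>R h) / h ^ ?d)\<^sup>2) \<partial>lborel) 
        = ennreal (h ^ ?d) * (\<integral>\<^sup>+u. ennreal ((K u / h ^ ?d)\<^sup>2) \<partial>lborel)"
      using h by (subst nn_integral_lborel_affine[of _ "- h" y]) auto
    also have "(\<integral>\<^sup>+u. ennreal ((K u / h ^ ?d)\<^sup>2) \<partial>lborel) = ennreal (\<integral>u. (K u / h ^ ?d)\<^sup>2 \<partial>lborel)"
      using K2 by (intro nn_integral_eq_integral) (auto simp: power_divide)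
    also have "(\<integral>u. (K u / h ^ ?d)\<^sup>2 \<partial>lborel) = ?\<kappa> / (h ^ ?d)\<^sup>2" by (simp add: power_divide)
    also have "ennreal (h ^ ?d) * ennreal (?\<kappa> / (h ^ ?d)\<^sup>2) = ennreal (?\<kappa> / h ^ ?d)"
      using h by (simp add: ennreal_mult'[symmetric] power2_eq_square)
    finally show ?thesis .
  qed
  have "(\<integral>\<^sup>+x. (\<integral>\<^sup>+b. ennreal (indicator (UNIV \<times> A) b * (K ((fst b - x) /\<^sub>R h) / h ^ ?d)\<^sup>2) \<partial>joint_law p q) \<partial>lborel)
      = (\<integral>\<^sup>+b. (\<integral>\<^sup>+x. ennreal (indicator (UNIV \<times> A) b * (K ((fst b - x) /\<^sub>R h) / h ^ ?d)\<^sup>2) \<partial>lborel) \<partial>joint_law p q)"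
    by (rule Fubini') measurable
  also have "\<dots> = (\<integral>\<^sup>+b. ennreal (?\<kappa> / h ^ ?d) * indicator (UNIV \<times> A) b \<partial>joint_law p q)"
  proof (intro nn_integral_cong)
    fix b :: "(real ^ 'dx) \<times> (real ^ 'dz)"
    show "(\<integral>\<^sup>+x. ennreal (indicator (UNIV \<times> A) b * (K ((fst b - x) /\<^sub>R h) / h ^ ?d)\<^sup>2) \<partial>lborel)
        = ennreal (?\<kappa> / h ^ ?d) * indicator (UNIV \<times> A) b"
      using inner[of "fst b"] by (cases "b \<in> UNIV \<times> A") simp_all
  qed
  also have "\<dots> = ennreal (?\<kappa> / h ^ ?d) * ennreal (cell_mass A)"
    by (subst nn_integral_cmult_indicator) (simp_all add: cell_mass_def joint.emeasure_eq_measure)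
  also have "\<dots> = ennreal (?\<kappa> / h ^ ?d * cell_mass A)"
    using h by (simp add: ennreal_mult'[symmetric] cell_mass_nonneg del: times_divide_eq_left)
  finally show ?thesis .
qed

lemma integrated_error_in_bin:
  fixes K :: "real ^ 'dx \<Rightarrow> real" and h \<tau> B :: real and m n :: nat and j :: "'dz \<Rightarrow> nat"
  assumes K[measurable]: "K \<in> borel_measurable borel" and K2: "integrable lborel (\<lambda>u. (K u)\<^sup>2)"
    and h: "0 < h" and \<tau>: "0 < \<tau>" and n: "1 \<le> n"
    and j: "j \<in> bin_indices m" and pos: "0 < cell_mass (bin m j)" and z: "z \<in> bin m j"
    and B: "0 \<le> B"
    and bias: "\<And>z'. z' \<in> bin m j \<Longrightarrow> (\<integral>\<^sup>+x\<in>unit_cube. ennreal \<bar>smoothed K h x z' - p x z\<bar> \<partial>lborel) \<le> ennreal B"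
  shows "(\<integral>\<^sup>+x\<in>unit_cube. (\<integral>\<^sup>+s. ennreal \<bar>cond_density_estimator K h m n s x z - p x z\<bar> \<partial>(\<Pi>\<^sub>M i\<in>{1..n}. joint_law p q)) \<partial>lborel)
    \<le> ennreal (\<tau> * (\<integral>u. (K u)\<^sup>2 \<partial>lborel) / (2 * h ^ CARD('dx)) + (1 / \<tau> + 1) / (real n * cell_mass (bin m j)) + B)"
proof -
  define A where "A = bin m j"
  define \<mu> where "\<mu> = cell_mass A"
  define \<kappa> where "\<kappa> = (\<integral>u. (K u)\<^sup>2 \<partial>lborel)"
  have A[measurable]: "A \<in> sets borel" by (simp add: A_def)
  have \<mu>: "0 < \<mu>" using pos by (simp add: \<mu>_def A_def)
  have \<kappa>: "0 \<le> \<kappa>" by (simp add: \<kappa>_def)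
  have zc: "z \<in> unit_cube" using bin_subset_unit_cube[OF j] z by auto
  note [measurable] = smoothed_meas[OF K, of h]
  let ?V = "\<lambda>x. \<integral>\<^sup>+b. ennreal (indicator (UNIV \<times> A) b * (K ((fst b - x) /\<^sub>R h) / h ^ CARD('dx))\<^sup>2) \<partial>joint_law p q"
  let ?D = "\<lambda>x. \<integral>\<^sup>+z'. indicator A z' * ennreal (q z' * \<bar>smoothed K h x z' - p x z\<bar>) \<partial>lborel"
  have V_meas[measurable]: "?V \<in> borel_measurable lborel" by measurable
  have D_meas[measurable]: "?D \<in> borel_measurable lborel" by measurable
  have "(\<integral>\<^sup>+x\<in>unit_cube. (\<integral>\<^sup>+s. ennreal \<bar>cond_density_estimator K h m n s x z - p x z\<bar> \<partial>(\<Pi>\<^sub>M i\<in>{1..n}. joint_law p q)) \<partial>lborel)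
      \<le> (\<integral>\<^sup>+x. ennreal (\<tau> / (2 * \<mu>)) * ?V x + ennreal (1 / \<tau> / (real n * \<mu>)) * indicator unit_cube x 
          + ennreal (1 / (real n * \<mu>)) * ennreal (p x z) + ennreal (1 / \<mu>) * (?D x * indicator unit_cube x) \<partial>lborel)"
  proof (rule nn_integral_mono)
    fix x :: "real ^ 'dx"
    have split: "ennreal ((1 / \<tau> + p x z) / (real n * \<mu>)) = ennreal (1 / \<tau> / (real n * \<mu>)) + ennreal (1 / (real n * \<mu>)) * ennreal (p x z)"
      using \<tau> \<mu> p_nonneg[of x z] by (simp add: ennreal_mult'[symmetric] add_divide_distrib flip: ennreal_plus)
    show "(\<integral>\<^sup>+s. ennreal \<bar>cond_density_estimator K h m n s x z - p x z\<bar> \<partial>(\<Pi>\<^sub>M i\<in>{1..n}. joint_law p q)) * indicator unit_cube x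
        \<le> ennreal (\<tau> / (2 * \<mu>)) * ?V x + ennreal (1 / \<tau> / (real n * \<mu>)) * indicator unit_cube x 
          + ennreal (1 / (real n * \<mu>)) * ennreal (p x z) + ennreal (1 / \<mu>) * (?D x * indicator unit_cube x)"
    proof (cases "x \<in> unit_cube")
      case True
      then show ?thesis
        using expected_error_in_bin[OF K h \<tau> n j pos z, of x, folded A_def, folded \<mu>_def, unfolded split]
        by (simp add: add_ac)
    qed simp
  qed
  also have "\<dots> = ennreal (\<tau> / (2 * \<mu>)) * (\<integral>\<^sup>+x. ?V x \<partial>lborel) + ennreal (1 / \<tau> / (real n * \<mu>)) 
      + ennreal (1 / (real n * \<mu>)) * (\<integral>\<^sup>+x. ennreal (p x z) \<partial>lborel) 
      + ennreal (1 / \<mu>) * (\<integral>\<^sup>+x. ?D x * indicator unit_cube x \<partial>lborel)"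
    by (simp add: nn_integral_add nn_integral_cmult nn_integral_cmult_indicator emeasure_unit_cube)
  also have "\<dots> \<le> ennreal (\<tau> / (2 * \<mu>)) * ennreal (\<kappa> / h ^ CARD('dx) * \<mu>) + ennreal (1 / \<tau> / (real n * \<mu>)) 
      + ennreal (1 / (real n * \<mu>)) * 1 + ennreal (1 / \<mu>) * ennreal (\<mu> * B)"
  proof (intro add_mono mult_left_mono order_refl)
    show "(\<integral>\<^sup>+x. ?V x \<partial>lborel) \<le> ennreal (\<kappa> / h ^ CARD('dx) * \<mu>)"
      using integrated_kernel_second_moment[OF K K2 h A] by (simp add: \<kappa>_def \<mu>_def)
    show "(\<integral>\<^sup>+x. ennreal (p x z) \<partial>lborel) \<le> 1" using p_total[OF zc] by simp
    have "(\<integral>\<^sup>+x. ?D x * indicator unit_cube x \<partial>lborel) 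
        = (\<integral>\<^sup>+x. (\<integral>\<^sup>+z'. indicator A z' * ennreal (q z' * \<bar>smoothed K h x z' - p x z\<bar>) * indicator unit_cube x \<partial>lborel) \<partial>lborel)"
      by (intro nn_integral_cong nn_integral_multc[symmetric]) measurable
    also have "\<dots> = (\<integral>\<^sup>+z'. (\<integral>\<^sup>+x. indicator A z' * ennreal (q z' * \<bar>smoothed K h x z' - p x z\<bar>) * indicator unit_cube x \<partial>lborel) \<partial>lborel)"
      by (rule lborel_pair.Fubini') measurable
    also have "\<dots> = (\<integral>\<^sup>+z'. indicator A z' * ennreal (q z') * (\<integral>\<^sup>+x\<in>unit_cube. ennreal \<bar>smoothed K h x z' - p x z\<bar> \<partial>lborel) \<partial>lborel)"
      by (subst nn_integral_cmult[symmetric]) (auto simp: ennreal_mult' q_nonneg mult_ac intro!: nn_integral_cong)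
    also have "\<dots> \<le> (\<integral>\<^sup>+z'. indicator A z' * ennreal (q z') * ennreal B \<partial>lborel)"
    proof (rule nn_integral_mono)
      fix z' :: "real ^ 'dz"
      show "indicator A z' * ennreal (q z') * (\<integral>\<^sup>+x\<in>unit_cube. ennreal \<bar>smoothed K h x z' - p x z\<bar> \<partial>lborel)
          \<le> indicator A z' * ennreal (q z') * ennreal B"
        using bias[of z'] by (cases "z' \<in> A") (auto simp: A_def intro: mult_left_mono)
    qed
    also have "\<dots> = ennreal (\<mu> * B)"
      using B by (subst nn_integral_multc) (auto simp: cell_mass_eq[symmetric] \<mu>_def ennreal_mult' cell_mass_nonneg)
    finally show "(\<integral>\<^sup>+x. ?D x * indicator unit_cube x \<partial>lborel) \<le> ennreal (\<mu> * B)" .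
  qed simp_all
  also have "\<dots> = ennreal (\<tau> / (2 * \<mu>) * (\<kappa> / h ^ CARD('dx) * \<mu>) + 1 / \<tau> / (real n * \<mu>) 
      + 1 / (real n * \<mu>) + 1 / \<mu> * (\<mu> * B))"
    using \<tau> \<mu> \<kappa> h B by (simp add: ennreal_mult'[symmetric] flip: ennreal_plus)
  also have "\<tau> / (2 * \<mu>) * (\<kappa> / h ^ CARD('dx) * \<mu>) + 1 / \<tau> / (real n * \<mu>) + 1 / (real n * \<mu>) + 1 / \<mu> * (\<mu> * B)
      = \<tau> * \<kappa> / (2 * h ^ CARD('dx)) + (1 / \<tau> + 1) / (real n * \<mu>) + B"
    using \<mu> by (simp add: add_divide_distrib mult_ac)
  finally show ?thesis by (simp only: \<mu>_def A_def \<kappa>_def)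
qed

lemma estimator_measurable:
  fixes K :: "real ^ 'dx \<Rightarrow> real"
  assumes K[measurable]: "K \<in> borel_measurable borel"
    and f: "f \<in> measurable M (\<Pi>\<^sub>M i\<in>{1..n}. joint_law p q)" 
    and g: "g \<in> borel_measurable M" and e: "e \<in> borel_measurable M"
  shows "(\<lambda>w. cond_density_estimator K h m n (f w) (g w) (e w)) \<in> borel_measurable M"
proof -
  let ?Q = "\<Pi>\<^sub>M i\<in>{1..n}. joint_law p q"
  have "(\<lambda>w. cond_density_estimator K h m n (fst (fst w)) (snd (fst w)) (snd w)) 
      \<in> borel_measurable ((?Q \<Otimes>\<^sub>M borel) \<Otimes>\<^sub>M borel)"
    unfolding cond_density_estimator_def by measurable
  from measurable_compose[OF _ this, of "\<lambda>w. ((f w, g w), e w)" M] show ?thesis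
    using f g e by simp
qed

text \<open>Multiplying the error in a bin by the mass of the bin cancels the mass in the denominator. A bin of
  mass 0 contributes nothing, as \<open>q\<close> vanishes almost everywhere on it; this is why the comparison of
  integrands holds only almost everywhere.\<close>

lemma estimator_risk_le:
  fixes K :: "real ^ 'dx \<Rightarrow> real" and h \<tau> B :: real and m n :: nat
  assumes K[measurable]: "K \<in> borel_measurable borel" and K2: "integrable lborel (\<lambda>u. (K u)\<^sup>2)"
    and h: "0 < h" and \<tau>: "0 < \<tau>" and n: "1 \<le> n" and m: "0 < m" and B: "0 \<le> B"
    and bias: "\<And>j z z'. j \<in> bin_indices m \<Longrightarrow> z \<in> bin m j \<Longrightarrow> z' \<in> bin m j \<Longrightarrow> 
      (\<integral>\<^sup>+x\<in>unit_cube. ennreal \<bar>smoothed K h x z' - p x z\<bar> \<partial>lborel) \<le> ennreal B"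
  shows "estimator_risk K h m n p q 
    \<le> ennreal (\<tau> * (\<integral>u. (K u)\<^sup>2 \<partial>lborel) / (2 * h ^ CARD('dx)) + (1 / \<tau> + 1) * real m ^ CARD('dz) / real n + B)"
proof -
  let ?Q = "\<Pi>\<^sub>M i\<in>{1..n}. joint_law p q"
  let ?est = "\<lambda>s x z. cond_density_estimator K h m n s x z"
  let ?J = "bin_indices m :: ('dz \<Rightarrow> nat) set"
  define \<kappa> where "\<kappa> = (\<integral>u. (K u)\<^sup>2 \<partial>lborel)"
  have \<kappa>: "0 \<le> \<kappa>" by (simp add: \<kappa>_def)
  interpret Q: prob_space ?Q by (rule prob_space_PiM) (rule joint.prob_space_axioms)
  interpret Qx: pair_sigma_finite ?Q "lborel :: (real ^ 'dx) measure" ..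
  interpret Qz: pair_sigma_finite ?Q "lborel :: (real ^ 'dz) measure" ..
  note [measurable (raw)] = estimator_measurable[OF K]
  define H where "H = (\<lambda>z. \<integral>\<^sup>+x\<in>unit_cube. (\<integral>\<^sup>+s. ennreal \<bar>?est s x z - p x z\<bar> \<partial>?Q) \<partial>lborel)"
  have "estimator_risk K h m n p q = (\<integral>\<^sup>+z. (\<integral>\<^sup>+s. (\<integral>\<^sup>+x\<in>unit_cube. ennreal (\<bar>?est s x z - p x z\<bar> * q z) \<partial>lborel) * indicator unit_cube z \<partial>?Q) \<partial>lborel)"
    unfolding estimator_risk_def by (rule Qz.Fubini'[symmetric]) measurable
  also have "\<dots> = (\<integral>\<^sup>+z. H z * ennreal (q z) * indicator unit_cube z \<partial>lborel)"
  proof (intro nn_integral_cong)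
    fix z :: "real ^ 'dz"
    have "(\<integral>\<^sup>+s. (\<integral>\<^sup>+x\<in>unit_cube. ennreal (\<bar>?est s x z - p x z\<bar> * q z) \<partial>lborel) * indicator unit_cube z \<partial>?Q)
        = (\<integral>\<^sup>+s. (\<integral>\<^sup>+x\<in>unit_cube. ennreal (\<bar>?est s x z - p x z\<bar> * q z) \<partial>lborel) \<partial>?Q) * indicator unit_cube z"
      by (rule nn_integral_multc) measurable
    also have "(\<integral>\<^sup>+s. (\<integral>\<^sup>+x\<in>unit_cube. ennreal (\<bar>?est s x z - p x z\<bar> * q z) \<partial>lborel) \<partial>?Q)
        = (\<integral>\<^sup>+x. (\<integral>\<^sup>+s. ennreal (\<bar>?est s x z - p x z\<bar> * q z) * indicator unit_cube x \<partial>?Q) \<partial>lborel)"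
      by (rule Qx.Fubini'[symmetric]) measurable
    also have "\<dots> = (\<integral>\<^sup>+x. (\<integral>\<^sup>+s. ennreal \<bar>?est s x z - p x z\<bar> \<partial>?Q) * indicator unit_cube x * ennreal (q z) \<partial>lborel)"
    proof (intro nn_integral_cong)
      fix x :: "real ^ 'dx"
      have "(\<integral>\<^sup>+s. ennreal (\<bar>?est s x z - p x z\<bar> * q z) * indicator unit_cube x \<partial>?Q)
          = (\<integral>\<^sup>+s. ennreal \<bar>?est s x z - p x z\<bar> * (indicator unit_cube x * ennreal (q z)) \<partial>?Q)"
        by (intro nn_integral_cong) (simp add: ennreal_mult' q_nonneg mult_ac)
      also have "\<dots> = (\<integral>\<^sup>+s. ennreal \<bar>?est s x z - p x z\<bar> \<partial>?Q) * (indicator unit_cube x * ennreal (q z))"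
        by (rule nn_integral_multc) measurable
      finally show "(\<integral>\<^sup>+s. ennreal (\<bar>?est s x z - p x z\<bar> * q z) * indicator unit_cube x \<partial>?Q)
          = (\<integral>\<^sup>+s. ennreal \<bar>?est s x z - p x z\<bar> \<partial>?Q) * indicator unit_cube x * ennreal (q z)"
        by (simp add: mult_ac)
    qed
    also have "\<dots> = H z * ennreal (q z)"
      unfolding H_def by (rule nn_integral_multc) measurable
    finally show "(\<integral>\<^sup>+s. (\<integral>\<^sup>+x\<in>unit_cube. ennreal (\<bar>?est s x z - p x z\<bar> * q z) \<partial>lborel) * indicator unit_cube z \<partial>?Q)
        = H z * ennreal (q z) * indicator unit_cube z" .
  qed
  also have "\<dots> \<le> (\<integral>\<^sup>+z. (\<Sum>j\<in>?J. ennreal (\<tau> * \<kappa> / (2 * h ^ CARD('dx)) + (1 / \<tau> + 1) / (real n * cell_mass (bin m j)) + B) 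
        * (indicator (bin m j) z * ennreal (q z))) \<partial>lborel)"
  proof (rule nn_integral_mono_AE)
    have "AE z in lborel. \<forall>j\<in>?J. cell_mass (bin m j) = 0 \<longrightarrow> indicator (bin m j) z * ennreal (q z) = 0"
    proof (rule AE_finite_allI[OF finite_bin_indices])
      fix j :: "'dz \<Rightarrow> nat"
      show "AE z in lborel. cell_mass (bin m j) = 0 \<longrightarrow> indicator (bin m j) z * ennreal (q z) = 0"
      proof (cases "cell_mass (bin m j) = 0")
        case True
        then have "(\<integral>\<^sup>+z. indicator (bin m j) z * ennreal (q z) \<partial>lborel) = 0"
          by (simp add: cell_mass_eq[symmetric])
        then have "AE z in lborel. indicator (bin m j) z * ennreal (q z) = 0"
          by (subst (asm) nn_integral_0_iff_AE) auto
        then show ?thesis by (rule AE_mp) auto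
      qed simp
    qed
    then show "AE z in lborel. H z * ennreal (q z) * indicator unit_cube z 
      \<le> (\<Sum>j\<in>?J. ennreal (\<tau> * \<kappa> / (2 * h ^ CARD('dx)) + (1 / \<tau> + 1) / (real n * cell_mass (bin m j)) + B) 
        * (indicator (bin m j) z * ennreal (q z)))"
    proof (rule AE_mp, intro AE_I2 impI)
      fix z :: "real ^ 'dz"
      assume null: "\<forall>j\<in>?J. cell_mass (bin m j) = 0 \<longrightarrow> indicator (bin m j) z * ennreal (q z) = 0"
      let ?c = "\<lambda>j. ennreal (\<tau> * \<kappa> / (2 * h ^ CARD('dx)) + (1 / \<tau> + 1) / (real n * cell_mass (bin m j)) + B)"
      show "H z * ennreal (q z) * indicator unit_cube z \<le> (\<Sum>j\<in>?J. ?c j * (indicator (bin m j) z * ennreal (q z)))"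
      proof (cases "z \<in> unit_cube")
        case True
        then obtain j where j: "j \<in> ?J" and z: "z \<in> bin m j" using bin_cover[OF m] by blast
        have "H z * ennreal (q z) \<le> ?c j * (indicator (bin m j) z * ennreal (q z))"
        proof (cases "cell_mass (bin m j) = 0")
          case True
          then have "ennreal (q z) = 0" using null j z by (metis indicator_simps(1) mult_1)
          then show ?thesis by simp
        next
          case False
          then have "0 < cell_mass (bin m j)" using cell_mass_nonneg[of "bin m j"] by simp
          then have "H z \<le> ?c j" unfolding H_def \<kappa>_def
            using bias[OF j z] by (intro integrated_error_in_bin[OF K K2 h \<tau> n j _ z B]) auto
          then show ?thesis using z by (simp add: mult_right_mono)
        qed
        also have "\<dots> \<le> (\<Sum>j\<in>?J. ?c j * (indicator (bin m j) z * ennreal (q z)))"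
          by (rule member_le_sum) (use j finite_bin_indices in auto)
        finally show ?thesis using True by simp
      qed simp
    qed
  qed
  also have "\<dots> = (\<Sum>j\<in>?J. ennreal (\<tau> * \<kappa> / (2 * h ^ CARD('dx)) + (1 / \<tau> + 1) / (real n * cell_mass (bin m j)) + B) 
        * ennreal (cell_mass (bin m j)))"
    by (subst nn_integral_sum) (auto simp: nn_integral_cmult cell_mass_eq)
  also have "\<dots> \<le> (\<Sum>j\<in>?J. ennreal ((\<tau> * \<kappa> / (2 * h ^ CARD('dx)) + B) * cell_mass (bin m j) + (1 / \<tau> + 1) / real n))"
  proof (rule sum_mono)
    fix j :: "'dz \<Rightarrow> nat"
    show "ennreal (\<tau> * \<kappa> / (2 * h ^ CARD('dx)) + (1 / \<tau> + 1) / (real n * cell_mass (bin m j)) + B) * ennreal (cell_mass (bin m j))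
        \<le> ennreal ((\<tau> * \<kappa> / (2 * h ^ CARD('dx)) + B) * cell_mass (bin m j) + (1 / \<tau> + 1) / real n)"
    proof (cases "cell_mass (bin m j) = 0")
      case False
      then have "(\<tau> * \<kappa> / (2 * h ^ CARD('dx)) + (1 / \<tau> + 1) / (real n * cell_mass (bin m j)) + B) * cell_mass (bin m j)
          = (\<tau> * \<kappa> / (2 * h ^ CARD('dx)) + B) * cell_mass (bin m j) + (1 / \<tau> + 1) / real n"
      proof -
        have "c / (real n * cell_mass (bin m j)) * cell_mass (bin m j) = c / real n" for c
          using False by simp
        then show ?thesis by (simp only: distrib_right add_ac)
      qed
      then show ?thesis using \<tau> \<kappa> h B cell_mass_nonneg[of "bin m j"]
        by (subst ennreal_mult'[symmetric]) (simp_all add: add_nonneg_nonneg)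
    qed simp
  qed
  also have "\<dots> = ennreal ((\<tau> * \<kappa> / (2 * h ^ CARD('dx)) + B) * (\<Sum>j\<in>?J. cell_mass (bin m j)) + (1 / \<tau> + 1) / real n * real m ^ CARD('dz))"
  proof -
    have "(\<Sum>j\<in>?J. (\<tau> * \<kappa> / (2 * h ^ CARD('dx)) + B) * cell_mass (bin m j) + (1 / \<tau> + 1) / real n)
        = (\<tau> * \<kappa> / (2 * h ^ CARD('dx)) + B) * (\<Sum>j\<in>?J. cell_mass (bin m j)) + (1 / \<tau> + 1) / real n * real m ^ CARD('dz)"
      by (simp only: sum.distrib sum_constant card_bin_indices sum_distrib_left of_nat_power) (simp only: mult.commute)
    then show ?thesis
      using \<tau> \<kappa> h B cell_mass_nonneg by (subst sum_ennreal) (auto intro!: add_nonneg_nonneg mult_nonneg_nonneg)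
  qed
  also have "\<dots> \<le> ennreal ((\<tau> * \<kappa> / (2 * h ^ CARD('dx)) + B) * 1 + (1 / \<tau> + 1) / real n * real m ^ CARD('dz))"
  proof -
    have "(\<Sum>j\<in>?J. cell_mass (bin m j)) = joint.prob (\<Union>j\<in>?J. UNIV \<times> bin m j)"
      unfolding cell_mass_def
    proof (rule joint.finite_measure_finite_Union[symmetric])
      show "disjoint_family_on (\<lambda>j. (UNIV :: (real ^ 'dx) set) \<times> bin m j) ?J"
        unfolding disjoint_family_on_def
      proof (intro ballI impI equals0I)
        fix a b :: "'dz \<Rightarrow> nat" and w :: "(real ^ 'dx) \<times> (real ^ 'dz)"
        assume ab: "a \<in> ?J" "b \<in> ?J" "a \<noteq> b" and "w \<in> UNIV \<times> bin m a \<inter> UNIV \<times> bin m b"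
        then have "snd w \<in> bin m a" "snd w \<in> bin m b" by auto
        with bin_unique[OF ab(1,2)] ab(3) show False by blast
      qed
    qed (auto intro: finite_bin_indices[simplified])
    also have "\<dots> \<le> 1" by simp
    finally show ?thesis using \<tau> \<kappa> h B by (intro ennreal_leI add_right_mono mult_left_mono) auto
  qed
  finally show ?thesis by (simp add: \<kappa>_def add_ac)
qed

end

section \<open>Balancing bandwidth and bin width\<close>

lemma (in cond_density) bias_in_bin:
  fixes K :: "real ^ 'dx \<Rightarrow> real"
  assumes \<beta>: "0 < \<beta>" and \<gamma>: "0 < \<gamma>" and W: "0 \<le> W1" "0 \<le> W2" and K: "appropriate_kernel \<beta> K" and h: "0 < h"
    and p_off: "\<And>x z. x \<notin> unit_cube \<Longrightarrow> p x z = 0"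
    and holder: "holder_in_x \<beta> W1 p" and tv: "tv_smooth_in_z \<gamma> W2 p"
    and j: "j \<in> bin_indices m" and z: "z \<in> bin m j" "z' \<in> bin m j"
  shows "(\<integral>\<^sup>+x\<in>unit_cube. ennreal \<bar>smoothed K h x z' - p x z\<bar> \<partial>lborel) 
    \<le> ennreal ((1 + W1 + W1 * real CARD('dx) powr \<beta>) * h powr \<beta> * kernel_abs_moment \<beta> K 
        + W2 * (real CARD('dz) / real m) powr \<gamma>)"
proof -
  note [measurable] = kernel_measurable[OF \<beta> K]
  note [measurable] = smoothed_meas[of K h]
  have zc: "z \<in> unit_cube" "z' \<in> unit_cube" using z bin_subset_unit_cube[OF j] by auto
  have p_sec: "(\<lambda>x. p x z') \<in> borel_measurable borel" by measurable
  have "(\<integral>\<^sup>+x\<in>unit_cube. ennreal \<bar>smoothed K h x z' - p x z'\<bar> \<partial>lborel) 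
      \<le> ennreal ((1 + W1 + W1 * real CARD('dx) powr \<beta>) * h powr \<beta> * kernel_abs_moment \<beta> K)"
    unfolding smoothed_def
  proof (rule kernel_bias[OF \<beta> K W(1) h p_sec p_nonneg p_off p_total[OF zc(2)]])
    show "times_differentiable (strict_floor \<beta>) (\<lambda>x. p x z')"
      using holder zc(2) by (simp add: holder_in_x_def)
    fix "is" :: "'dx list" and x x' :: "real ^ 'dx"
    assume "length is = strict_floor \<beta>" "x \<in> unit_cube" "x' \<in> unit_cube"
    then show "\<bar>iterated_partial is (\<lambda>x. p x z') x - iterated_partial is (\<lambda>x. p x z') x'\<bar> 
        \<le> W1 * l1_norm (x - x') powr (\<beta> - real (strict_floor \<beta>))"
      using conjunct2[OF holder[unfolded holder_in_x_def], rule_format, of x x' z' "count_list is" "is"] zc(2)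
      by (simp add: sum_count_list_UNIV)
  qed
  moreover have "(\<integral>\<^sup>+x\<in>unit_cube. ennreal \<bar>p x z' - p x z\<bar> \<partial>lborel) \<le> ennreal (W2 * (real CARD('dz) / real m) powr \<gamma>)"
  proof -
    have "(\<integral>\<^sup>+x\<in>unit_cube. ennreal \<bar>p x z' - p x z\<bar> \<partial>lborel) \<le> ennreal (W2 * l1_norm (z' - z) powr \<gamma>)"
      using tv zc by (simp add: tv_smooth_in_z_def)
    also have "\<dots> \<le> ennreal (W2 * (real CARD('dz) / real m) powr \<gamma>)"
      using W \<gamma> bin_diameter[OF j z(2,1)]
      by (intro ennreal_leI mult_left_mono powr_mono2) (auto simp: l1_norm_nonneg)
    finally show ?thesis .
  qed
  moreover have "(\<integral>\<^sup>+x\<in>unit_cube. ennreal \<bar>smoothed K h x z' - p x z\<bar> \<partial>lborel)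
      \<le> (\<integral>\<^sup>+x\<in>unit_cube. ennreal \<bar>smoothed K h x z' - p x z'\<bar> \<partial>lborel) 
        + (\<integral>\<^sup>+x\<in>unit_cube. ennreal \<bar>p x z' - p x z\<bar> \<partial>lborel)"
  proof (subst nn_integral_add[symmetric])
    show "(\<integral>\<^sup>+x\<in>unit_cube. ennreal \<bar>smoothed K h x z' - p x z\<bar> \<partial>lborel) 
        \<le> (\<integral>\<^sup>+x. ennreal \<bar>smoothed K h x z' - p x z'\<bar> * indicator unit_cube x 
            + ennreal \<bar>p x z' - p x z\<bar> * indicator unit_cube x \<partial>lborel)"
      by (intro nn_integral_mono) (auto simp: indicator_def simp flip: ennreal_plus intro!: ennreal_leI)
  qed measurable
  ultimately have "(\<integral>\<^sup>+x\<in>unit_cube. ennreal \<bar>smoothed K h x z' - p x z\<bar> \<partial>lborel)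
      \<le> ennreal ((1 + W1 + W1 * real CARD('dx) powr \<beta>) * h powr \<beta> * kernel_abs_moment \<beta> K)
        + ennreal (W2 * (real CARD('dz) / real m) powr \<gamma>)"
    by (meson add_mono order_trans)
  then show ?thesis
    using W kernel_abs_moment_nonneg[OF \<beta> K] by (subst ennreal_plus) auto
qed

text \<open>The finitely many indices not covered by the asymptotic bound are absorbed into the constant, as
  \<open>g\<close> is positive there.\<close>

lemma bigo_imp_bound_everywhere:
  fixes f g :: "nat \<Rightarrow> real"
  assumes "f \<in> O(g)" and g: "\<And>n. 1 \<le> n \<Longrightarrow> 0 < g n"
  shows "\<exists>C>0. \<forall>n\<ge>1. \<bar>f n\<bar> \<le> C * g n"
proof -
  obtain c N where c: "0 < c" and N: "\<forall>n\<ge>N. \<bar>f n\<bar> \<le> c * \<bar>g n\<bar>"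
    using assms(1) unfolding bigo_def eventually_sequentially by auto
  let ?S = "\<Sum>i=1..N. \<bar>f i\<bar> / g i"
  have S: "0 \<le> ?S" using g by (intro sum_nonneg) (auto intro!: divide_nonneg_pos)
  have "\<bar>f n\<bar> \<le> (c + ?S) * g n" if n: "1 \<le> n" for n
  proof (cases "N \<le> n")
    case True
    have "\<bar>f n\<bar> \<le> c * g n" using N True g[OF n] by auto
    also have "\<dots> \<le> (c + ?S) * g n" using S g[OF n] by (intro mult_right_mono) auto
    finally show ?thesis .
  next
    case False
    have "\<bar>f n\<bar> / g n \<le> ?S"
    proof (rule member_le_sum)
      fix i assume "i \<in> {1..N} - {n}"
      then show "0 \<le> \<bar>f i\<bar> / g i" using g[of i] by simp
    qed (use False n in auto)
    then have "\<bar>f n\<bar> \<le> ?S * g n" using g[OF n] by (simp add: pos_divide_le_eq)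
    also have "\<dots> \<le> (c + ?S) * g n" using c g[OF n] by (intro mult_right_mono) auto
    finally show ?thesis .
  qed
  moreover have "0 < c + ?S" using c S by linarith
  ultimately show ?thesis by blast
qed

lemma bigtheta_imp_bounds_everywhere:
  fixes f g :: "nat \<Rightarrow> real"
  assumes "f \<in> \<Theta>(g)" and f: "\<And>n. 1 \<le> n \<Longrightarrow> 0 < f n" and g: "\<And>n. 1 \<le> n \<Longrightarrow> 0 < g n"
  obtains c C where "0 < c" "0 < C" "\<And>n. 1 \<le> n \<Longrightarrow> c * g n \<le> f n" "\<And>n. 1 \<le> n \<Longrightarrow> f n \<le> C * g n"
proof -
  have fg: "f \<in> O(g)" and gf: "g \<in> O(f)" using assms(1) by (auto simp: bigtheta_def bigomega_iff_bigo)
  obtain C where C: "0 < C" "\<forall>n\<ge>1. \<bar>f n\<bar> \<le> C * g n" using bigo_imp_bound_everywhere[OF fg g] by blast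
  obtain c where c: "0 < c" "\<forall>n\<ge>1. \<bar>g n\<bar> \<le> c * f n" using bigo_imp_bound_everywhere[OF gf f] by blast
  show ?thesis
  proof (rule that[of "1 / c" C])
    fix n :: nat assume n: "1 \<le> n"
    have "g n \<le> c * f n" using c(2) n g[OF n] by auto
    then show "1 / c * g n \<le> f n" using c(1) by (simp add: field_simps)
    show "f n \<le> C * g n" using C(2) n f[OF n] by auto
  qed (use c C in auto)
qed

text \<open>The variance term \<open>m ^ dz / (n r h ^ dx)\<close> is bounded by a power of \<open>n\<close> with the exponent
  \<open>(dz \<beta> / \<gamma> + dx + \<beta> - D) / D = - \<beta> / D\<close>, by the definition of \<open>D\<close>; this equality with the exponent
  of the bias \<open>h powr \<beta>\<close> is what determines \<open>D\<close>. The factor \<open>h ^ dx\<close> in the weight \<open>r * h ^ dx\<close>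
  compensates the blow-up of \<open>\<integral>K\<^sup>2 / h ^ dx\<close>.\<close>

lemma balanced_risk_bound:
  fixes \<beta> \<gamma> h c1 C1 c2 C2 \<kappa> b1 b2 :: real and dx dz n m :: nat
  assumes \<beta>: "0 < \<beta>" and \<gamma>: "0 < \<gamma>" and n: "1 \<le> n" and dz: "0 < dz"
    and pos: "0 < c1" "0 < C1" "0 < c2" "0 < C2" and b: "0 \<le> b1" "0 \<le> b2"
  defines "D \<equiv> real dx + real dz * \<beta> / \<gamma> + 2 * \<beta>"
  defines "r \<equiv> real n powr (- \<beta> / D)"
  assumes h: "c1 * real n powr (- 1 / D) \<le> h" "h \<le> C1 * real n powr (- 1 / D)"
    and m: "c2 * real n powr ((\<beta> / \<gamma>) / D) \<le> real m" "real m \<le> C2 * real n powr ((\<beta> / \<gamma>) / D)"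
  shows "(r * h ^ dx) * \<kappa> / (2 * h ^ dx) + (1 / (r * h ^ dx) + 1) * real m ^ dz / real n 
      + (b1 * h powr \<beta> + b2 * (real dz / real m) powr \<gamma>)
    \<le> (\<kappa> / 2 + C2 ^ dz / c1 ^ dx + C2 ^ dz + b1 * C1 powr \<beta> + b2 * (real dz / c2) powr \<gamma>) * r"
proof -
  have D: "0 < D" using \<beta> \<gamma> unfolding D_def by (intro add_nonneg_pos) auto
  have N: "1 \<le> real n" using n by simp
  have r: "0 < r" using N by (simp add: r_def)
  have hpos: "0 < h" 
    by (rule less_le_trans[OF _ h(1)]) (use pos N in simp)
  have mpos: "0 < real m" 
    by (rule less_le_trans[OF _ m(1)]) (use pos N in simp)
  have powr_power: "(real n powr a) ^ k = real n powr (a * real k)" for a k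
    using N by (subst powr_power) (auto simp: mult.commute)
  have T1: "(r * h ^ dx) * \<kappa> / (2 * h ^ dx) = \<kappa> / 2 * r" using hpos by simp
  have mz: "real m ^ dz \<le> C2 ^ dz * real n powr ((\<beta> / \<gamma>) / D * real dz)"
    using power_mono[OF m(2), of dz] by (simp add: power_mult_distrib powr_power)
  have hx: "c1 ^ dx * real n powr (- 1 / D * real dx) \<le> h ^ dx"
    using power_mono[OF h(1), of dx] pos(1) by (simp add: power_mult_distrib powr_power)
  have T2: "1 / (r * h ^ dx) * real m ^ dz / real n \<le> C2 ^ dz / c1 ^ dx * r"
  proof -
    have "1 / (r * h ^ dx) * real m ^ dz / real n = real m ^ dz / (r * h ^ dx * real n)" by simp
    also have "\<dots> \<le> (C2 ^ dz * real n powr ((\<beta> / \<gamma>) / D * real dz)) / (r * (c1 ^ dx * real n powr (- 1 / D * real dx)) * real n)"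
      using r hpos N pos by (intro frac_le mz mult_right_mono mult_left_mono hx) auto
    also have "\<dots> = C2 ^ dz / c1 ^ dx * (real n powr ((\<beta> / \<gamma>) / D * real dz) / (r * real n powr (- 1 / D * real dx) * real n powr 1))"
      using N by simp
    also have "real n powr ((\<beta> / \<gamma>) / D * real dz) / (r * real n powr (- 1 / D * real dx) * real n powr 1) 
        = real n powr ((\<beta> / \<gamma>) / D * real dz - (- \<beta> / D + - 1 / D * real dx + 1))"
      unfolding r_def by (simp only: powr_diff powr_add)
    also have "(\<beta> / \<gamma>) / D * real dz - (- \<beta> / D + - 1 / D * real dx + 1) = - \<beta> / D"
    proof -
      have "(\<beta> / \<gamma>) / D * real dz - (- \<beta> / D + - 1 / D * real dx + 1) = (real dz * \<beta> / \<gamma> + \<beta> + real dx - D) / D"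
        using D by (simp add: add_divide_distrib diff_divide_distrib mult.commute)
      also have "real dz * \<beta> / \<gamma> + \<beta> + real dx - D = - \<beta>" by (simp add: D_def)
      finally show ?thesis .
    qed
    finally show ?thesis by (simp add: r_def)
  qed
  have T3: "real m ^ dz / real n \<le> C2 ^ dz * r"
  proof -
    have "real m ^ dz / real n \<le> C2 ^ dz * real n powr ((\<beta> / \<gamma>) / D * real dz) / real n powr 1"
      using mz N by (simp add: divide_right_mono)
    also have "\<dots> = C2 ^ dz * real n powr ((\<beta> / \<gamma>) / D * real dz - 1)"
      by (simp only: powr_diff times_divide_eq_right)
    also have "\<dots> \<le> C2 ^ dz * r" unfolding r_def
    proof (intro mult_left_mono powr_mono N)
      have "(\<beta> / \<gamma>) / D * real dz - 1 = (real dz * \<beta> / \<gamma> - D) / D"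
        using D by (simp add: diff_divide_distrib mult.commute)
      also have "\<dots> \<le> - \<beta> / D" using D \<beta> by (intro divide_right_mono) (auto simp: D_def)
      finally show "(\<beta> / \<gamma>) / D * real dz - 1 \<le> - \<beta> / D" .
    qed (use pos in simp)
    finally show ?thesis .
  qed
  have T4: "h powr \<beta> \<le> C1 powr \<beta> * r"
  proof -
    have "h powr \<beta> \<le> (C1 * real n powr (- 1 / D)) powr \<beta>" using hpos h \<beta> by (intro powr_mono2) auto
    also have "\<dots> = C1 powr \<beta> * r" using pos by (simp add: powr_mult powr_powr r_def)
    finally show ?thesis .
  qed
  have T5: "(real dz / real m) powr \<gamma> \<le> (real dz / c2) powr \<gamma> * r"
  proof -
    have "real dz / real m \<le> real dz / (c2 * real n powr ((\<beta> / \<gamma>) / D))"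
      using m(1) mpos pos N by (intro divide_left_mono mult_pos_pos) auto
    then have "(real dz / real m) powr \<gamma> \<le> (real dz / (c2 * real n powr ((\<beta> / \<gamma>) / D))) powr \<gamma>"
      using \<gamma> by (intro powr_mono2) auto
    also have "real dz / (c2 * real n powr ((\<beta> / \<gamma>) / D)) = real dz / c2 * real n powr (- ((\<beta> / \<gamma>) / D))"
      by (simp add: powr_minus_divide)
    also have "\<dots> powr \<gamma> = (real dz / c2) powr \<gamma> * (real n powr (- ((\<beta> / \<gamma>) / D))) powr \<gamma>"
      by (rule powr_mult)
    also have "(real n powr (- ((\<beta> / \<gamma>) / D))) powr \<gamma> = r"
      using \<gamma> by (simp add: powr_powr r_def)
    finally show ?thesis .
  qed
  have "(r * h ^ dx) * \<kappa> / (2 * h ^ dx) + (1 / (r * h ^ dx) + 1) * real m ^ dz / real n 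
      + (b1 * h powr \<beta> + b2 * (real dz / real m) powr \<gamma>)
    = (r * h ^ dx) * \<kappa> / (2 * h ^ dx) + 1 / (r * h ^ dx) * real m ^ dz / real n + real m ^ dz / real n
      + (b1 * h powr \<beta> + b2 * (real dz / real m) powr \<gamma>)"
    by (simp add: distrib_right add_divide_distrib)
  also have "\<dots> \<le> \<kappa> / 2 * r + C2 ^ dz / c1 ^ dx * r + C2 ^ dz * r + (b1 * (C1 powr \<beta> * r) + b2 * ((real dz / c2) powr \<gamma> * r))"
    unfolding T1 using b by (intro add_mono T2 T3 mult_left_mono T4 T5 order_refl) auto
  also have "\<dots> = (\<kappa> / 2 + C2 ^ dz / c1 ^ dx + C2 ^ dz + b1 * C1 powr \<beta> + b2 * (real dz / c2) powr \<gamma>) * r"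
    by (simp add: distrib_right mult.assoc)
  finally show ?thesis .
qed

theorem theorem3p5:
  fixes K :: "real ^ 'dx \<Rightarrow> real"
    and \<beta> \<gamma> W1 W2 :: real
    and h :: "nat \<Rightarrow> real" and m :: "nat \<Rightarrow> nat"
  assumes "0 < \<beta>" and "0 < \<gamma>" and "\<gamma> \<le> 1" and "0 < W1" and "0 < W2"
    and "appropriate_kernel \<beta> K"
    and "\<forall>n\<ge>1. 0 < h n"
    and "h \<in> \<Theta>(\<lambda>n. real n powr
           (- 1 / (real CARD('dx) + real CARD('dz) * \<beta> / \<gamma> + 2 * \<beta>)))"
    and "\<forall>n\<ge>1. 0 < m n"
    and "(\<lambda>n. real (m n)) \<in> \<Theta>(\<lambda>n. real n powr
           ((\<beta> / \<gamma>) / (real CARD('dx) + real CARD('dz) * \<beta> / \<gamma> + 2 * \<beta>)))"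
  shows "\<exists>C>0. \<forall>n\<ge>1. \<forall>(p :: real ^ 'dx \<Rightarrow> real ^ 'dz \<Rightarrow> real, q) \<in> density_class \<beta> \<gamma> W1 W2.
           estimator_risk K (h n) (m n) n p q
             \<le> ennreal (C * real n powr (- 1 / (real CARD('dx) / \<beta> + real CARD('dz) / \<gamma> + 2)))"
proof -
  note \<beta> = assms(1) and \<gamma> = assms(2) and K = assms(6)
  let ?dx = "CARD('dx)" and ?dz = "CARD('dz)"
  define D where "D = real ?dx + real ?dz * \<beta> / \<gamma> + 2 * \<beta>"
  define \<kappa> where "\<kappa> = (\<integral>u. (K u)\<^sup>2 \<partial>lborel)"
  define b1 where "b1 = (1 + W1 + W1 * real ?dx powr \<beta>) * kernel_abs_moment \<beta> K"
  have D: "0 < D" using \<beta> \<gamma> unfolding D_def by (intro add_nonneg_pos) auto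
  obtain c1 C1 where h_bounds: "0 < c1" "0 < C1" 
      "\<And>n. 1 \<le> n \<Longrightarrow> c1 * real n powr (- 1 / D) \<le> h n" "\<And>n. 1 \<le> n \<Longrightarrow> h n \<le> C1 * real n powr (- 1 / D)"
    by (rule bigtheta_imp_bounds_everywhere[OF assms(8)[folded D_def]]) (use assms(7) in auto)
  obtain c2 C2 where m_bounds: "0 < c2" "0 < C2" 
      "\<And>n. 1 \<le> n \<Longrightarrow> c2 * real n powr ((\<beta> / \<gamma>) / D) \<le> real (m n)" 
      "\<And>n. 1 \<le> n \<Longrightarrow> real (m n) \<le> C2 * real n powr ((\<beta> / \<gamma>) / D)"
    by (rule bigtheta_imp_bounds_everywhere[OF assms(10)[folded D_def]]) (use assms(9) in auto)
  define C where "C = \<kappa> / 2 + C2 ^ ?dz / c1 ^ ?dx + C2 ^ ?dz + b1 * C1 powr \<beta> + W2 * (real ?dz / c2) powr \<gamma>"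
  have \<kappa>: "0 \<le> \<kappa>" by (simp add: \<kappa>_def)
  have b1: "0 \<le> b1" unfolding b1_def
    using assms(4) kernel_abs_moment_nonneg[OF \<beta> K] by (intro mult_nonneg_nonneg) auto
  have C: "0 < C" unfolding C_def
    using \<kappa> b1 h_bounds m_bounds assms(5)
    by (intro add_pos_nonneg add_nonneg_pos mult_nonneg_nonneg) auto
  have rate: "- 1 / (real ?dx / \<beta> + real ?dz / \<gamma> + 2) = - \<beta> / D"
  proof -
    have "D = \<beta> * (real ?dx / \<beta> + real ?dz / \<gamma> + 2)"
      using \<beta> by (simp add: D_def field_simps)
    then show ?thesis using \<beta> by simp
  qed
  have "estimator_risk K (h n) (m n) n p q \<le> ennreal (C * real n powr (- \<beta> / D))"
    if n: "1 \<le> n" and pq: "(p, q) \<in> density_class \<beta> \<gamma> W1 W2" 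
    for n and p :: "real ^ 'dx \<Rightarrow> real ^ 'dz \<Rightarrow> real" and q
  proof -
    interpret cond_density p q
      using pq by unfold_locales (auto simp: density_class_def)
    have p_off: "\<And>x z. x \<notin> unit_cube \<Longrightarrow> p x z = 0" 
      and holder: "holder_in_x \<beta> W1 p" and tv: "tv_smooth_in_z \<gamma> W2 p"
      using pq by (auto simp: density_class_def)
    have hn: "0 < h n" and mn: "0 < m n" using assms(7,9) n by auto
    \<comment> \<open>The target rate; \<open>r * h n ^ d\<^sub>X\<close> serves as the weight \<open>\<tau>\<close>.\<close>
    define r where "r = real n powr (- \<beta> / D)"
    define B where "B = b1 * h n powr \<beta> + W2 * (real ?dz / real (m n)) powr \<gamma>"
    have r: "0 < r * h n ^ ?dx" using n hn by (simp add: r_def)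
    have B: "0 \<le> B" using b1 assms(5) by (simp add: B_def)
    have "estimator_risk K (h n) (m n) n p q 
        \<le> ennreal (r * h n ^ ?dx * \<kappa> / (2 * h n ^ ?dx) + (1 / (r * h n ^ ?dx) + 1) * real (m n) ^ ?dz / real n + B)"
      unfolding \<kappa>_def
    proof (rule estimator_risk_le[OF kernel_measurable[OF \<beta> K] _ hn r n mn B])
      show "integrable lborel (\<lambda>u. (K u)\<^sup>2)" using K by (simp add: appropriate_kernel_def)
      fix j and z z' :: "real ^ 'dz"
      assume "j \<in> bin_indices (m n)" "z \<in> bin (m n) j" "z' \<in> bin (m n) j"
      then show "(\<integral>\<^sup>+x\<in>unit_cube. ennreal \<bar>smoothed K (h n) x z' - p x z\<bar> \<partial>lborel) \<le> ennreal B"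
        using bias_in_bin[OF \<beta> \<gamma> _ _ K hn p_off holder tv, of j "m n" z z'] assms(4,5)
        by (simp add: B_def b1_def mult_ac)
    qed
    also have "\<dots> \<le> ennreal (C * r)"
      unfolding B_def C_def r_def D_def
      by (intro ennreal_leI balanced_risk_bound \<beta> \<gamma> n h_bounds[unfolded D_def] m_bounds[unfolded D_def] b1)
        (use assms(5) in auto)
    finally show ?thesis by (simp add: r_def)
  qed
  then show ?thesis using C unfolding rate by blast
qed

end
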